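(* Let $E$ be a complete locally convex space, let $-\infty\le\alpha\le\infty$, let $\mu$ be a finite $\alpha$-concave measure on $E$, and let $u,v:E\to\mathbb{R}$ be lower semi-continuous $\mu$-integrable functions such that $$\int_E u\,d\mu>0,\qquad \int_E v\,d\mu>0.$$ Then there exist points $a,b\in E$ and a finite $\alpha$-concave measure $\nu$ supported on the segment $\Delta=[a,b]$ such that $$\int_\Delta u\,d\nu>0,\qquad \int_\Delta v\,d\nu>0.$$
   Context: Locally convex spaces are real and Hausdorff; complete means that every Cauchy net converges. The segment $[a,b]$ is $\{(1-t)a+tb: 0\le t\le 1\}$ (possibly $a=b$). A measure is supported on a closed set if the complement of that set has measure zero. A positive Radon measure $\mu$ on a locally convex space $E$ is called $\alpha$-concave ($-\infty\le\alpha\le\infty$) if for all $0<t<1$ and all Borel sets $A,B\subset E$ with $\mu(A)>0$ and $\mu(B)>0$, $$\mu_*\big((1-t)A+tB\big)\ge\big[(1-t)\mu(A)^\alpha+t\mu(B)^\alpha\big]^{1/\alpha},$$ where $(1-t)A+tB=\{(1-t)x+ty:x\in A,\,y\in B\}$ and $\mu_*$ is the inner measure. The right-hand side is understood as $\min\{\mu(A),\mu(B)\}$ for $\alpha=-\infty$, as $\mu(A)^{1-t}\mu(B)^t$ for $\alpha=0$, and as $\max\{\mu(A),\mu(B)\}$ for $\alpha=\infty$. *)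

theory Defs
  imports "HOL-Analysis.Analysis"
begin

text \<open>
  Real Hausdorff locally convex spaces. The class \<open>uniform_topological_group_add\<close> forces the
  uniformity to be the canonical translation-invariant one of the additive group, so no choice of
  uniform structure is involved, and \<open>complete UNIV\<close> (every Cauchy filter converges) is completeness
  in the sense of topological vector spaces, i.e. convergence of all Cauchy nets. The constant
  \<open>convex\<close> is not available inside the class specification, so its definition is written out.
\<close>

class locally_convex_space = real_vector + uniform_topological_group_add + t2_space +
  assumes tendsto_scaleR_nhds:
    "((\<lambda>p. fst p *\<^sub>R snd p) \<longlongrightarrow> c *\<^sub>R x) (nhds c \<times>\<^sub>F nhds x)"
  and open_convex_basis:
    "open U \<Longrightarrow> 0 \<in> U \<Longrightarrow>
       \<exists>V. open V \<and> (\<forall>x\<in>V. \<forall>y\<in>V. \<forall>s\<ge>0. \<forall>t\<ge>0. s + t = 1 \<longrightarrow> s *\<^sub>R x + t *\<^sub>R y \<in> V) \<and>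
           0 \<in> V \<and> V \<subseteq> U"

definition lower_semicontinuous :: "('a::topological_space \<Rightarrow> real) \<Rightarrow> bool" where
  "lower_semicontinuous f \<longleftrightarrow> (\<forall>c. open {x. c < f x})"

definition radon_measure :: "'a::topological_space measure \<Rightarrow> bool" where
  "radon_measure M \<longleftrightarrow>
     sets M = sets borel \<and>
     (\<forall>x. \<exists>U. open U \<and> x \<in> U \<and> emeasure M U < \<infinity>) \<and>
     (\<forall>A\<in>sets borel. emeasure M A = (SUP K\<in>{K. compact K \<and> K \<in> sets borel \<and> K \<subseteq> A}. emeasure M K))"

definition inner_measure :: "'a measure \<Rightarrow> 'a set \<Rightarrow> ennreal" where
  "inner_measure M S = (SUP A\<in>{A \<in> sets M. A \<subseteq> S}. emeasure M A)"

text \<open>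
  Powers of extended nonnegative reals with a real exponent: the usual convention \<open>x\<^sup>0 = 1\<close>, and
  otherwise extended to the arguments 0 and \<open>\<infinity>\<close> by continuity. (The library's \<open>powr\<close> on reals
  satisfies \<open>0 powr p = 0\<close> for every \<open>p\<close>.)
\<close>

definition ennreal_powr :: "ennreal \<Rightarrow> real \<Rightarrow> ennreal" where
  "ennreal_powr x p =
     (if p = 0 then 1
      else if x = 0 then (if p > 0 then 0 else \<infinity>)
      else if x = \<infinity> then (if p > 0 then \<infinity> else 0)
      else ennreal (enn2real x powr p))"

definition power_mean :: "ereal \<Rightarrow> real \<Rightarrow> ennreal \<Rightarrow> ennreal \<Rightarrow> ennreal" where
  "power_mean \<alpha> t x y =
     (if \<alpha> = -\<infinity> then min x y
      else if \<alpha> = \<infinity> then max x y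
      else if \<alpha> = 0 then ennreal_powr x (1 - t) * ennreal_powr y t
      else ennreal_powr
             (ennreal (1 - t) * ennreal_powr x (real_of_ereal \<alpha>) +
              ennreal t * ennreal_powr y (real_of_ereal \<alpha>))
             (1 / real_of_ereal \<alpha>))"

definition alpha_concave :: "ereal \<Rightarrow> 'a::locally_convex_space measure \<Rightarrow> bool" where
  "alpha_concave \<alpha> M \<longleftrightarrow>
     radon_measure M \<and>
     (\<forall>t A B. 0 < t \<longrightarrow> t < 1 \<longrightarrow> A \<in> sets borel \<longrightarrow> B \<in> sets borel \<longrightarrow>
        emeasure M A > 0 \<longrightarrow> emeasure M B > 0 \<longrightarrow>
        inner_measure M {(1 - t) *\<^sub>R x + t *\<^sub>R y |x y. x \<in> A \<and> y \<in> B}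
          \<ge> power_mean \<alpha> t (emeasure M A) (emeasure M B))"

definition supported_on :: "'a::topological_space measure \<Rightarrow> 'a set \<Rightarrow> bool" where
  "supported_on M S \<longleftrightarrow> closed S \<and> emeasure M (- S) = 0"

text \<open>
  The integral of \<open>f\<close> over \<open>A\<close> with values in the extended reals. For lower semicontinuous \<open>f\<close>, compact
  \<open>A\<close> and finite \<open>M\<close>, \<open>f\<close> is bounded below on \<open>A\<close>, so the second term is finite and the integral is
  well defined with values in \<open>(-\<infinity>, \<infinity>]\<close>, though \<open>f\<close> need not be integrable; the Bochner integral would
  be 0 by convention when \<open>f\<close> is not. (The difference is not meaningful if both terms are \<open>\<infinity>\<close>.)
\<close>

definition extended_set_integral :: "'a measure \<Rightarrow> 'a set \<Rightarrow> ('a \<Rightarrow> real) \<Rightarrow> ereal" where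
  "extended_set_integral M A f =
     enn2ereal (\<integral>\<^sup>+x\<in>A. ennreal (f x) \<partial>M) - enn2ereal (\<integral>\<^sup>+x\<in>A. ennreal (- f x) \<partial>M)"

end

theory Submission
  imports Defs "HOL-Probability.Helly_Selection"
begin

text \<open>
  The measure on the segment is found by repeated bisection, in the manner of Lovasz and Simonovits.
  The space may be infinite-dimensional and nonmetrizable, but the problem can be reduced to
  finitely many continuous linear functionals, and the only limit of measures is taken on the real
  line, where Helly's selection theorem applies.

  \<^item> Completeness makes closed convex hulls of compact sets compact
    (\<open>compact_closed_convex_hull\<close>), and restricting a concave measure to a convex set keeps it
    concave. Since \<open>\<mu>\<close> is Radon, \<open>E\<close> may therefore be replaced by a compact convex set \<open>K\<close>.

  \<^item> On \<open>K\<close> there are continuous functions \<open>f \<le> u\<close> and \<open>g \<le> v\<close>, still with positive integrals, that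
    depend only on the values of finitely many continuous linear functionals
    (\<open>cylinder_minorant\<close>). This uses the separation step in the proof of the Stone-Weierstrass
    theorem, for which the functionals have to separate points, that is, the Hahn-Banach theorem.
    From here on only this finite set \<open>\<Lambda>\<close> of functionals matters.

  \<^item> For two functionals and a point of the plane, rotating a half-plane about that point gives
    a position that halves the integral of \<open>f\<close>, and one of the two halves has a positive integral of
    \<open>g\<close> (\<open>halfplane_bisection\<close>). The rotation argument needs that the boundary lines are null sets; a
    line that is not null carries the whole measure
    (\<open>compact_concave_hyperplane_zero_one\<close>), and then there is nothing to cut.

  \<^item> Cutting successively for all pairs from \<open>\<Lambda>\<close> and all rational points gives compact convex sets
    decreasing to a set \<open>S\<close> on which every functional of \<open>\<Lambda>\<close> is an affine function of a single
    functional \<open>l0\<close>: otherwise some pair of functionals would map \<open>S\<close> onto a planar set with an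
    interior rational point, contrary to the cut made there (\<open>functionals_collapse\<close>).

  \<^item> The normalised restrictions of \<open>\<mu>\<close> to the decreasing sets are pushed to the real line by \<open>l0\<close>. By
    Helly's selection theorem they have a weak limit point, which is again concave
    (\<open>compact_concave_weak_limit\<close>) and lives on \<open>l0 ` S\<close>. An affine section of \<open>l0\<close> maps this interval
    onto a segment in \<open>S\<close> and transports the limit there. Since \<open>f\<close> and \<open>g\<close> restricted to \<open>S\<close> are
    functions of \<open>l0\<close>, their integrals are controlled by the limit; to keep them strictly
    positive the bisection is run with \<open>f - e1\<close> and \<open>g - e2\<close> for small constants.
\<close>

section \<open>Continuous linear functionals separate points\<close>

lemma tendsto_scaleR_lcs [tendsto_intros]:
  fixes g :: "'b \<Rightarrow> 'a::locally_convex_space"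
  assumes "(f \<longlongrightarrow> c) F" "(g \<longlongrightarrow> x) F"
  shows "((\<lambda>z. f z *\<^sub>R g z) \<longlongrightarrow> c *\<^sub>R x) F"
  using filterlim_compose[OF tendsto_scaleR_nhds filterlim_Pair[OF assms]] by simp

lemma continuous_on_scaleR_lcs [continuous_intros]:
  fixes g :: "'b::topological_space \<Rightarrow> 'a::locally_convex_space"
  assumes "continuous_on S f" "continuous_on S g"
  shows "continuous_on S (\<lambda>z. f z *\<^sub>R g z)"
  using assms unfolding continuous_on_def by (auto intro: tendsto_scaleR_lcs)

lemma convex_nhd_0:
  fixes U :: "'a::locally_convex_space set"
  assumes "open U" "0 \<in> U"
  obtains V where "open V" "convex V" "0 \<in> V" "V \<subseteq> U"
  using open_convex_basis[OF assms] unfolding convex_def by metis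

lemma symmetric_convex_nhd_0:
  fixes U :: "'a::locally_convex_space set"
  assumes "open U" "0 \<in> U"
  obtains V where "open V" "convex V" "0 \<in> V" "V \<subseteq> U" "\<And>x. x \<in> V \<Longrightarrow> - x \<in> V"
proof -
  obtain V where V: "open V" "convex V" "0 \<in> V" "V \<subseteq> U"
    using convex_nhd_0[OF assms] .
  have eq: "uminus -` V = uminus ` V"
    by (auto simp: image_iff) (metis add.inverse_inverse)
  have "open (uminus -` V)"
    by (intro open_vimage V continuous_intros)
  moreover have "convex (uminus -` V)"
    unfolding eq using V(2) by (simp add: convex_negations)
  ultimately show thesis
    using V by (intro that[of "V \<inter> uminus -` V"]) (auto intro: convex_Int)
qed

definition sublinear :: "('a::real_vector \<Rightarrow> real) \<Rightarrow> bool" where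
  "sublinear p \<longleftrightarrow> (\<forall>x y. p (x + y) \<le> p x + p y) \<and> (\<forall>c\<ge>0. \<forall>x. p (c *\<^sub>R x) = c * p x)"

lemma sublinearI:
  assumes sub: "\<And>x y. p (x + y) \<le> p x + p y"
    and hom: "\<And>c x. 0 < c \<Longrightarrow> p (c *\<^sub>R x) \<le> c * p x"
    and zero: "p 0 = 0"
  shows "sublinear p"
proof -
  have "p (c *\<^sub>R x) = c * p x" if "0 < c" for c x
  proof (rule antisym)
    have "p x \<le> inverse c * p (c *\<^sub>R x)"
      using hom[of "inverse c" "c *\<^sub>R x"] that by simp
    then show "c * p x \<le> p (c *\<^sub>R x)"
      using that by (simp add: field_simps)
  qed (use hom that in blast)
  then show ?thesis
    unfolding sublinear_def using sub zero by (metis less_eq_real_def mult_zero_left scaleR_zero_left)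
qed

lemma sublinear_add: "sublinear p \<Longrightarrow> p (x + y) \<le> p x + p y"
  and sublinear_scaleR: "sublinear p \<Longrightarrow> 0 \<le> c \<Longrightarrow> p (c *\<^sub>R x) = c * p x"
  by (auto simp: sublinear_def)

lemma sublinear_zero: "sublinear p \<Longrightarrow> p 0 = 0"
  using sublinear_scaleR[of p 0 0] by simp

lemma sublinear_uminus: "sublinear p \<Longrightarrow> - p (- x) \<le> p x"
  using sublinear_add[of p x "- x"] sublinear_zero[of p] by simp

text \<open>
  The function \<open>r\<close> is the largest sublinear functional below \<open>q\<close> that is compatible with \<open>r (- y) \<le> - q y\<close>,
  i.e. \<open>q\<close> made additive in the direction \<open>y\<close>. A minimal sublinear functional is unchanged by this
  for every \<open>y\<close> and is therefore odd, hence linear.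
\<close>

lemma sublinear_tilt:
  fixes q :: "'a::real_vector \<Rightarrow> real" and y :: 'a
  assumes q: "sublinear q"
  defines "r \<equiv> \<lambda>x. INF t\<in>{0..}. q (x + t *\<^sub>R y) - t * q y"
  shows "sublinear r" "\<And>x. r x \<le> q x" "r (- y) \<le> - q y"
proof -
  have bdd: "bdd_below ((\<lambda>t. q (x + t *\<^sub>R y) - t * q y) ` {0..})" for x
  proof (rule bdd_belowI2)
    fix t :: real assume "t \<in> {0..}"
    then show "- q (- x) \<le> q (x + t *\<^sub>R y) - t * q y"
      using sublinear_add[OF q, of "x + t *\<^sub>R y" "- x"] sublinear_scaleR[OF q, of t y] by simp
  qed
  have lower: "r x \<le> q (x + t *\<^sub>R y) - t * q y" if "0 \<le> t" for x t
    unfolding r_def using bdd that by (intro cINF_lower) auto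
  have greatest: "c \<le> r x" if "\<And>t. 0 \<le> t \<Longrightarrow> c \<le> q (x + t *\<^sub>R y) - t * q y" for c x
    unfolding r_def using that by (intro cINF_greatest) auto
  show "r x \<le> q x" for x
    using lower[of 0 x] by simp
  show "r (- y) \<le> - q y"
    using lower[of 1 "- y"] sublinear_zero[OF q] by simp
  show "sublinear r"
  proof (rule sublinearI)
    fix x z
    have "r (x + z) - (q (x + s *\<^sub>R y) - s * q y) \<le> q (z + t *\<^sub>R y) - t * q y"
      if "0 \<le> s" "0 \<le> t" for s t
      using lower[of "s + t" "x + z"] sublinear_add[OF q, of "x + s *\<^sub>R y" "z + t *\<^sub>R y"] that
      by (simp add: algebra_simps)
    then have "r (x + z) - r z \<le> q (x + s *\<^sub>R y) - s * q y" if "0 \<le> s" for s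
      using greatest[of "r (x + z) - (q (x + s *\<^sub>R y) - s * q y)" z] that by fastforce
    from greatest[OF this] show "r (x + z) \<le> r x + r z"
      by simp
  next
    fix c :: real and x assume c: "0 < c"
    have "inverse c * r (c *\<^sub>R x) \<le> r x"
    proof (rule greatest)
      fix t :: real assume t: "0 \<le> t"
      have "r (c *\<^sub>R x) \<le> q (c *\<^sub>R (x + t *\<^sub>R y)) - c * t * q y"
        using lower[of "c * t" "c *\<^sub>R x"] c t by (simp add: algebra_simps)
      also have "\<dots> = c * (q (x + t *\<^sub>R y) - t * q y)"
        using sublinear_scaleR[OF q, of c "x + t *\<^sub>R y"] c by (simp add: algebra_simps)
      finally show "inverse c * r (c *\<^sub>R x) \<le> q (x + t *\<^sub>R y) - t * q y"
        using c by (simp add: field_simps)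
    qed
    then show "r (c *\<^sub>R x) \<le> c * r x"
      using c by (simp add: field_simps)
  next
    have "0 \<le> r 0"
      by (rule greatest) (simp add: sublinear_scaleR[OF q])
    then show "r 0 = 0"
      using lower[of 0 0] sublinear_zero[OF q] by simp
  qed
qed

text \<open>
  Zorn's lemma applies because a chain of sublinear functionals below \<open>p\<close> is bounded below pointwise, by
  \<open>- p (- x)\<close>, and its pointwise infimum is sublinear: two members of a chain are comparable, so
  the smaller one can be used in the subadditivity estimate.
\<close>

lemma minimal_sublinear_exists:
  fixes p :: "'a::real_vector \<Rightarrow> real"
  assumes p: "sublinear p"
  obtains m where "sublinear m" "\<And>x. m x \<le> p x"
    "\<And>q. sublinear q \<Longrightarrow> (\<And>x. q x \<le> m x) \<Longrightarrow> q = m"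
proof -
  define A where "A = {q. sublinear q \<and> (\<forall>x. q x \<le> p x)}"
  let ?P = "\<lambda>q r :: 'a \<Rightarrow> real. \<forall>x. r x \<le> q x"
  have "\<exists>m\<in>A. \<forall>q\<in>A. ?P m q \<longrightarrow> q = m"
  proof (rule predicate_Zorn)
    show "partial_order_on A (relation_of ?P A)"
      by (rule partial_order_on_relation_ofI) (auto intro: order_trans intro!: ext antisym)
  next
    fix C assume "C \<in> Chains (relation_of ?P A)"
    then have C: "C \<subseteq> A" "\<And>q r. q \<in> C \<Longrightarrow> r \<in> C \<Longrightarrow> ?P q r \<or> ?P r q"
      by (auto simp: Chains_def relation_of_def)
    show "\<exists>u\<in>A. \<forall>a\<in>C. ?P a u"
    proof (cases "C = {}")
      case True
      then show ?thesis using p by (auto simp: A_def)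
    next
      case False
      define u where "u x = (INF q\<in>C. q x)" for x
      have bdd: "bdd_below ((\<lambda>q. q x) ` C)" for x
      proof (rule bdd_belowI2)
        fix q assume "q \<in> C"
        then have "sublinear q" "q (- x) \<le> p (- x)" using C by (auto simp: A_def)
        then show "- p (- x) \<le> q x" using sublinear_uminus[of q x] by simp
      qed
      have lower: "u x \<le> q x" if "q \<in> C" for q x
        unfolding u_def using bdd that by (intro cINF_lower) auto
      have greatest: "c \<le> u x" if "\<And>q. q \<in> C \<Longrightarrow> c \<le> q x" for c x
        unfolding u_def using that False by (intro cINF_greatest) auto
      have sl: "sublinear q" if "q \<in> C" for q using C that by (auto simp: A_def)
      have "sublinear u"
      proof (rule sublinearI)
        fix x y
        have *: "u (x + y) - q x \<le> r y" if qr: "q \<in> C" "r \<in> C" for q r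
        proof -
          have "\<exists>s\<in>C. s x \<le> q x \<and> s y \<le> r y"
            using C(2)[OF qr] qr by auto
          then obtain s where s: "s \<in> C" "s x \<le> q x" "s y \<le> r y" by blast
          then show ?thesis
            using lower[OF s(1), of "x + y"] sublinear_add[OF sl[OF s(1)], of x y] by simp
        qed
        have "u (x + y) - u y \<le> q x" if "q \<in> C" for q
          using greatest[of "u (x + y) - q x" y] * that by fastforce
        then show "u (x + y) \<le> u x + u y" using greatest[of "u (x + y) - u y" x] by simp
      next
        fix c :: real and x assume c: "0 < c"
        have "inverse c * u (c *\<^sub>R x) \<le> u x"
        proof (rule greatest)
          fix q assume q: "q \<in> C"
          show "inverse c * u (c *\<^sub>R x) \<le> q x"
            using lower[OF q, of "c *\<^sub>R x"] sublinear_scaleR[OF sl[OF q], of c x] c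
            by (simp add: field_simps)
        qed
        then show "u (c *\<^sub>R x) \<le> c * u x" using c by (simp add: field_simps)
      next
        show "u 0 = 0"
          unfolding u_def using False sl by (simp add: sublinear_zero)
      qed
      moreover have "u x \<le> p x" for x
      proof -
        obtain q where "q \<in> C" using False by blast
        then show ?thesis using lower[of q x] C(1) by (auto simp: A_def intro: order_trans)
      qed
      ultimately show ?thesis using lower by (auto simp: A_def)
    qed
  qed
  then obtain m where m: "m \<in> A" "\<And>q. q \<in> A \<Longrightarrow> ?P m q \<Longrightarrow> q = m" by blast
  show thesis
  proof (rule that)
    show "sublinear m" "\<And>x. m x \<le> p x" using m(1) by (auto simp: A_def)
    then show "q = m" if "sublinear q" "\<And>x. q x \<le> m x" for q
      using that m(2)[of q] by (auto simp: A_def intro: order_trans)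
  qed
qed

text \<open>
  Tilting \<open>p\<close> in the direction \<open>x0\<close> before passing to a minimal functional forces the value at \<open>x0\<close>.
\<close>

theorem Hahn_Banach_sublinear:
  fixes p :: "'a::real_vector \<Rightarrow> real"
  assumes p: "sublinear p"
  obtains l where "linear l" "\<And>x. l x \<le> p x" "l x0 = p x0"
proof -
  define p' where "p' x = (INF t\<in>{0..}. p (x + t *\<^sub>R x0) - t * p x0)" for x
  note p' = sublinear_tilt[OF p, where y = x0, folded p'_def]
  obtain m where m: "sublinear m" "\<And>x. m x \<le> p' x"
    "\<And>q. sublinear q \<Longrightarrow> (\<And>x. q x \<le> m x) \<Longrightarrow> q = m"
    using minimal_sublinear_exists[OF p'(1)] by blast
  have odd: "m (- y) = - m y" for y
  proof (rule antisym)
    define r where "r x = (INF t\<in>{0..}. m (x + t *\<^sub>R y) - t * m y)" for x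
    note r = sublinear_tilt[OF m(1), where y = y, folded r_def]
    have "r = m" by (rule m(3)[OF r(1,2)])
    then show "m (- y) \<le> - m y" using r(3) by simp
    show "- m y \<le> m (- y)" using sublinear_uminus[OF m(1), of "- y"] by simp
  qed
  have "linear m"
  proof (rule linearI)
    fix x y
    show "m (x + y) = m x + m y"
      using sublinear_add[OF m(1), of x y] sublinear_add[OF m(1), of "x + y" "- y"] odd[of y] by simp
  next
    fix c x
    show "m (c *\<^sub>R x) = c *\<^sub>R m x"
    proof (cases "0 \<le> c")
      case True
      then show ?thesis by (simp add: sublinear_scaleR[OF m(1)])
    next
      case False
      then show ?thesis
        using sublinear_scaleR[OF m(1), of "- c" x] odd[of "c *\<^sub>R x"] by simp
    qed
  qed
  moreover have "m x0 = p x0"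
    using m(2)[of "- x0"] m(2)[of x0] p'(2)[of x0] p'(3) odd[of x0] by simp
  moreover have "m x \<le> p x" for x
    using m(2) p'(2) order_trans by blast
  ultimately show thesis by (intro that)
qed

definition minkowski_gauge :: "'a::real_vector set \<Rightarrow> 'a \<Rightarrow> real" where
  "minkowski_gauge V x = Inf {s. 0 < s \<and> inverse s *\<^sub>R x \<in> V}"

lemma absorbing_nhd_0:
  fixes V :: "'a::locally_convex_space set"
  assumes "open V" "0 \<in> V"
  shows "\<exists>s>0. inverse s *\<^sub>R x \<in> V"
proof -
  have "((\<lambda>s. inverse s *\<^sub>R x) \<longlongrightarrow> 0 *\<^sub>R x) at_top"
    by (intro tendsto_scaleR_lcs tendsto_inverse_0_at_top filterlim_ident tendsto_const)
  then have "\<forall>\<^sub>F s in at_top. inverse s *\<^sub>R x \<in> V"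
    using assms by (auto dest: topological_tendstoD)
  then have "\<forall>\<^sub>F s in at_top. 0 < s \<and> inverse s *\<^sub>R x \<in> V"
    using eventually_gt_at_top[of 0] by eventually_elim auto
  then show ?thesis by (auto simp: eventually_at_top_linorder)
qed

lemma minkowski_gauge:
  fixes V :: "'a::locally_convex_space set"
  assumes V: "open V" "convex V" "0 \<in> V"
  shows sublinear_minkowski_gauge: "sublinear (minkowski_gauge V)"
    and minkowski_gauge_le_1: "x \<in> V \<Longrightarrow> minkowski_gauge V x \<le> 1"
    and minkowski_gauge_ge_1: "x \<notin> V \<Longrightarrow> 1 \<le> minkowski_gauge V x"
proof -
  let ?G = "\<lambda>x. {s. 0 < s \<and> inverse s *\<^sub>R x \<in> V}"
  have bdd: "bdd_below (?G x)" for x by (rule bdd_belowI[of _ 0]) auto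
  have ne: "?G x \<noteq> {}" for x using absorbing_nhd_0[OF V(1,3), of x] by auto
  have lower: "minkowski_gauge V x \<le> s" if "0 < s" "inverse s *\<^sub>R x \<in> V" for x s
    unfolding minkowski_gauge_def using bdd that by (intro cInf_lower) auto
  have greatest: "c \<le> minkowski_gauge V x"
    if "\<And>s. 0 < s \<Longrightarrow> inverse s *\<^sub>R x \<in> V \<Longrightarrow> c \<le> s" for c x
    unfolding minkowski_gauge_def using ne that by (intro cInf_greatest) auto
  show "sublinear (minkowski_gauge V)"
  proof (rule sublinearI)
    fix x y
    have *: "minkowski_gauge V (x + y) - s \<le> t"
      if st: "0 < s" "inverse s *\<^sub>R x \<in> V" "0 < t" "inverse t *\<^sub>R y \<in> V" for s t
    proof -
      have "(s / (s + t)) *\<^sub>R (inverse s *\<^sub>R x) + (t / (s + t)) *\<^sub>R (inverse t *\<^sub>R y) \<in> V"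
        using st by (intro convexD[OF V(2)]) (auto simp: divide_simps)
      moreover have "(s / (s + t)) *\<^sub>R (inverse s *\<^sub>R x) + (t / (s + t)) *\<^sub>R (inverse t *\<^sub>R y)
        = inverse (s + t) *\<^sub>R (x + y)"
        using st by (simp add: scaleR_add_right inverse_eq_divide)
      ultimately have "minkowski_gauge V (x + y) \<le> s + t"
        using st by (intro lower) auto
      then show ?thesis by simp
    qed
    have "minkowski_gauge V (x + y) - minkowski_gauge V y \<le> s"
      if "0 < s" "inverse s *\<^sub>R x \<in> V" for s
      using greatest[of y "minkowski_gauge V (x + y) - s"] * that by fastforce
    then show "minkowski_gauge V (x + y) \<le> minkowski_gauge V x + minkowski_gauge V y"
      using greatest[of x "minkowski_gauge V (x + y) - minkowski_gauge V y"] by simp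
  next
    fix c :: real and x assume c: "0 < c"
    have "inverse c * minkowski_gauge V (c *\<^sub>R x) \<le> minkowski_gauge V x"
    proof (rule greatest)
      fix s assume "0 < s" "inverse s *\<^sub>R x \<in> V"
      then have "minkowski_gauge V (c *\<^sub>R x) \<le> c * s"
        using c by (intro lower) (auto simp: field_simps)
      then show "inverse c * minkowski_gauge V (c *\<^sub>R x) \<le> s"
        using c by (simp add: field_simps)
    qed
    then show "minkowski_gauge V (c *\<^sub>R x) \<le> c * minkowski_gauge V x"
      using c by (simp add: field_simps)
  next
    show "minkowski_gauge V 0 = 0"
    proof (rule antisym)
      show "minkowski_gauge V 0 \<le> 0"
        by (rule field_le_epsilon) (use V in \<open>auto intro: lower\<close>)
    qed (use greatest in force)
  qed
  show "minkowski_gauge V x \<le> 1" if "x \<in> V"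
    using that by (intro lower) auto
  show "1 \<le> minkowski_gauge V x" if "x \<notin> V"
  proof (rule greatest, rule ccontr)
    fix s assume s: "0 < s" "inverse s *\<^sub>R x \<in> V" "\<not> 1 \<le> s"
    have "s *\<^sub>R (inverse s *\<^sub>R x) + (1 - s) *\<^sub>R 0 \<in> V"
      using s V by (intro convexD) auto
    then show False using s that by simp
  qed
qed

lemma continuous_on_bounded_linear_functional:
  fixes l :: "'a::locally_convex_space \<Rightarrow> real"
  assumes l: "linear l" and V: "open V" "0 \<in> V" "\<And>x. x \<in> V \<Longrightarrow> \<bar>l x\<bar> \<le> 1"
  shows "continuous_on UNIV l"
proof -
  have "(l \<longlongrightarrow> l x) (at x)" for x
  proof (rule tendstoI)
    fix e :: real assume e: "0 < e"
    have "((\<lambda>y. (2 / e) *\<^sub>R (y - x)) \<longlongrightarrow> (2 / e) *\<^sub>R (x - x)) (at x)"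
      by (intro tendsto_intros)
    then have "\<forall>\<^sub>F y in at x. (2 / e) *\<^sub>R (y - x) \<in> V"
      using V by (auto dest: topological_tendstoD)
    then show "\<forall>\<^sub>F y in at x. dist (l y) (l x) < e"
    proof eventually_elim
      fix y assume "(2 / e) *\<^sub>R (y - x) \<in> V"
      then have "\<bar>(2 / e) * (l y - l x)\<bar> \<le> 1"
        using V(3)[of "(2 / e) *\<^sub>R (y - x)"] by (simp add: linear_scale[OF l] linear_diff[OF l])
      then have "(2 / e) * \<bar>l y - l x\<bar> \<le> 1" using e by (simp only: abs_mult) simp
      then have "\<bar>l y - l x\<bar> \<le> e / 2" using e by (simp add: field_simps)
      then show "dist (l y) (l x) < e" using e by (simp add: dist_real_def)
    qed
  qed
  then show ?thesis by (auto simp: continuous_on_def)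
qed

text \<open>
  A functional dominated by the gauge of a symmetric convex neighbourhood \<open>V\<close> is bounded by 1 on \<open>V\<close>,
  hence continuous; the gauge is at least 1 outside \<open>V\<close>.
\<close>

theorem continuous_linear_functionals_separate_points:
  fixes x y :: "'a::locally_convex_space"
  assumes "x \<noteq> y"
  obtains l :: "'a \<Rightarrow> real" where "linear l" "continuous_on UNIV l" "l x \<noteq> l y"
proof -
  obtain U where U: "open U" "0 \<in> U" "x - y \<notin> U"
    using separation_t1[of 0 "x - y"] assms by auto
  obtain V where V: "open V" "convex V" "0 \<in> V" "V \<subseteq> U" "\<And>x. x \<in> V \<Longrightarrow> - x \<in> V"
    using symmetric_convex_nhd_0[OF U(1,2)] by blast
  note gauge = minkowski_gauge[OF V(1-3)]
  obtain l where l: "linear l" "\<And>z. l z \<le> minkowski_gauge V z" "l (x - y) = minkowski_gauge V (x - y)"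
    using Hahn_Banach_sublinear[OF gauge(1)] by blast
  have le1: "l z \<le> 1" if "z \<in> V" for z
    using l(2)[of z] gauge(2)[OF that] by simp
  have "\<bar>l z\<bar> \<le> 1" if "z \<in> V" for z
    using le1[OF that] le1[OF V(5)[OF that]] linear_neg[OF l(1), of z] by auto
  then have "continuous_on UNIV l"
    using V by (intro continuous_on_bounded_linear_functional[OF l(1)]) auto
  moreover have "l x \<noteq> l y"
    using l(3) gauge(3)[of "x - y"] U(3) V(4) linear_diff[OF l(1), of x y] by fastforce
  ultimately show thesis using that l(1) by blast
qed

section \<open>Closed convex hulls of compact sets\<close>

text \<open>
  Translation invariance: entourages come from neighbourhoods of 0.
\<close>

lemma eventually_uniformity_nhd_0:
  fixes E :: "'a::uniform_topological_group_add \<times> 'a \<Rightarrow> bool"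
  assumes "eventually E uniformity"
  obtains U :: "'a set" where "open U" "0 \<in> U" "\<And>x y. y - x \<in> U \<Longrightarrow> E (x, y)"
proof -
  obtain Q where Q: "eventually Q uniformity" "\<And>a b c :: 'a. Q (a, b) \<Longrightarrow> E (a + c, b + c)"
    using uniformity_of_uniform_continuous_invariant[of "(+)" E] uniformly_continuous_add' assms by blast
  have "eventually (\<lambda>y. Q (0, y)) (nhds 0)"
    unfolding eventually_nhds_uniformity using Q(1) by (auto elim!: eventually_mono)
  then obtain U where U: "open U" "0 \<in> U" "\<And>y. y \<in> U \<Longrightarrow> Q (0, y)"
    by (auto simp: eventually_nhds)
  show thesis
  proof (rule that[OF U(1,2)])
    fix x y :: 'a assume "y - x \<in> U"
    then have "E (0 + x, (y - x) + x)" by (intro Q U)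
    then show "E (x, y)" by simp
  qed
qed

text \<open>
  A minimal proper filter decides every predicate: if it does not force \<open>P\<close>, adding the complement of \<open>P\<close>
  keeps it proper, so the complement was forced already.
\<close>

lemma ultrafilter_exists:
  assumes "F \<noteq> bot"
  obtains G where "G \<le> F" "G \<noteq> bot" "\<And>P. eventually P G \<or> eventually (\<lambda>x. \<not> P x) G"
proof -
  define A where "A = {G. G \<le> F \<and> G \<noteq> bot}"
  have "\<exists>m\<in>A. \<forall>G\<in>A. m \<ge> G \<longrightarrow> G = m"
  proof (rule predicate_Zorn)
    show "partial_order_on A (relation_of (\<ge>) A)"
      by (rule partial_order_on_relation_ofI) auto
  next
    fix C assume "C \<in> Chains (relation_of (\<ge>) A)"
    then have C: "C \<subseteq> A" "\<And>G H. G \<in> C \<Longrightarrow> H \<in> C \<Longrightarrow> G \<ge> H \<or> H \<ge> G"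
      by (auto simp: Chains_def relation_of_def)
    show "\<exists>u\<in>A. \<forall>a\<in>C. a \<ge> u"
    proof (cases "C = {}")
      case True
      then show ?thesis using assms by (auto simp: A_def)
    next
      case False
      have "Inf C \<noteq> bot"
      proof
        assume "Inf C = bot"
        then have "eventually (\<lambda>_. False) (Inf C)" by simp
        then obtain G where "G \<in> C" "eventually (\<lambda>_. False) G"
          using False C by (subst (asm) eventually_Inf_base) (auto, metis order_refl)
        then show False using C by (auto simp: A_def eventually_False)
      qed
      moreover have "Inf C \<le> F"
        using False C by (auto simp: A_def intro: Inf_lower2)
      ultimately show ?thesis by (auto simp: A_def intro: Inf_lower)
    qed
  qed
  then obtain G where G: "G \<le> F" "G \<noteq> bot" "\<And>H. H \<le> G \<Longrightarrow> H \<noteq> bot \<Longrightarrow> H = G"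
    by (auto simp: A_def intro: order_trans)
  have "eventually (\<lambda>x. \<not> P x) G" if "\<not> eventually P G" for P
  proof -
    have "inf G (principal {x. \<not> P x}) \<noteq> bot"
      using that by (simp add: trivial_limit_def eventually_inf_principal)
    then have "inf G (principal {x. \<not> P x}) = G" by (intro G) auto
    moreover have "eventually (\<lambda>x. \<not> P x) (inf G (principal {x. \<not> P x}))"
      by (simp add: eventually_inf_principal)
    ultimately show ?thesis by simp
  qed
  then show thesis using G that by blast
qed

text \<open>
  Every ultrafilter on a totally bounded set contains one of finitely many small sets, for every
  size, so it is Cauchy and converges.
\<close>

lemma compact_complete_totally_bounded:
  fixes S :: "'a::uniform_space set"
  assumes "complete (UNIV :: 'a set)" "totally_bounded S" "closed S"
  shows "compact S"
  unfolding compact_filter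
proof (intro allI impI)
  fix F :: "'a filter" assume F: "F \<noteq> bot" "\<forall>\<^sub>F x in F. x \<in> S"
  obtain G where G: "G \<le> F" "G \<noteq> bot" "\<And>P. eventually P G \<or> eventually (\<lambda>x. \<not> P x) G"
    using ultrafilter_exists[OF F(1)] by blast
  have GS: "\<forall>\<^sub>F x in G. x \<in> S" using F(2) G(1) by (rule filter_leD[rotated])
  have "cauchy_filter G"
    unfolding cauchy_filter_def
  proof (rule filter_leI)
    fix E :: "'a \<times> 'a \<Rightarrow> bool" assume "eventually E uniformity"
    then obtain D where D: "eventually D uniformity" "\<And>x y z. D (x, y) \<Longrightarrow> D (y, z) \<Longrightarrow> E (x, z)"
      by (rule uniformity_transE) blast
    let ?D = "\<lambda>(x, y). D (x, y) \<and> D (y, x)"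
    have "eventually ?D uniformity"
      using D(1) uniformity_sym[OF D(1)] by eventually_elim auto
    then obtain X where X: "finite X" "\<forall>s\<in>S. \<exists>x\<in>X. ?D (x, s)"
      using assms(2) unfolding totally_bounded_def by blast
    have "\<exists>x\<in>X. \<forall>\<^sub>F s in G. ?D (x, s)"
    proof (rule ccontr)
      assume "\<not> ?thesis"
      then have "\<forall>x\<in>X. \<forall>\<^sub>F s in G. \<not> ?D (x, s)" using G(3) by blast
      then have "\<forall>\<^sub>F s in G. \<forall>x\<in>X. \<not> ?D (x, s)"
        using X(1) by (simp add: eventually_ball_finite)
      with GS have "\<forall>\<^sub>F s in G. False"
        by eventually_elim (use X(2) in blast)
      then show False using G(2) by (simp add: eventually_False)
    qed
    then obtain x where x: "\<forall>\<^sub>F s in G. ?D (x, s)" by blast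
    then show "eventually E (G \<times>\<^sub>F G)"
      unfolding eventually_prod_same using D(2) by (intro exI[of _ "\<lambda>s. ?D (x, s)"]) auto
  qed
  then obtain x where x: "G \<le> nhds x"
    using assms(1) G(2) unfolding complete_uniform by (metis UNIV_I principal_UNIV top_greatest)
  have "x \<in> S"
    using assms(3) G(2) GS x Lim_in_closed_set[of S "\<lambda>x. x" G x] by (simp add: filterlim_def filtermap_ident)
  moreover have "inf (nhds x) F \<noteq> bot"
    using x G(1,2) by (metis bot.extremum_uniqueI le_inf_iff)
  ultimately show "\<exists>x\<in>S. inf (nhds x) F \<noteq> bot" by blast
qed

lemma compact_convex_hull_finite:
  fixes F :: "'a::locally_convex_space set"
  assumes "finite F"
  shows "compact (convex hull F)"
  using assms
proof (induction F)
  case (insert a F)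
  show ?case
  proof (cases "F = {}")
    case False
    let ?f = "\<lambda>(u, x). (1 - u) *\<^sub>R a + u *\<^sub>R x"
    have "convex hull (insert a F) = ?f ` ({0..1} \<times> (convex hull F))"
      using False by (force simp: convex_hull_insert_alt)
    moreover have "continuous_on ({0..1} \<times> (convex hull F)) ?f"
      unfolding case_prod_beta by (intro continuous_intros)
    ultimately show ?thesis
      by (simp add: compact_continuous_image compact_Times insert.IH)
  qed simp
qed simp

lemma convex_closure_lcs:
  fixes S :: "'a::locally_convex_space set"
  assumes "convex S"
  shows "convex (closure S)"
proof (rule convexI)
  fix x y :: 'a and u v :: real
  assume xy: "x \<in> closure S" "y \<in> closure S" and uv: "0 \<le> u" "0 \<le> v" "u + v = 1"
  let ?f = "\<lambda>p. u *\<^sub>R fst p + v *\<^sub>R snd p"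
  have "?f ` closure (S \<times> S) \<subseteq> closure S"
  proof (rule image_closure_subset)
    show "continuous_on (closure (S \<times> S)) ?f" by (intro continuous_intros)
    show "?f ` (S \<times> S) \<subseteq> closure S"
      using convexD[OF assms _ _ uv] closure_subset by fastforce
  qed simp
  moreover have "(x, y) \<in> closure (S \<times> S)" using xy by (simp add: closure_Times)
  ultimately show "u *\<^sub>R x + v *\<^sub>R y \<in> closure S" by fastforce
qed

text \<open>
  If \<open>C\<close> is within \<open>W\<close> of a finite set \<open>F\<close>, then \<open>convex hull C\<close> is within \<open>W\<close> of \<open>convex hull F\<close>,
  which is compact and hence within \<open>W\<close> of another finite set. Taking the closure costs a
  third \<open>W\<close>; so \<open>W\<close> is a third of a convex neighbourhood.
\<close>

theorem compact_closed_convex_hull: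
  fixes C :: "'a::locally_convex_space set"
  assumes "complete (UNIV :: 'a set)" "compact C"
  shows "compact (closure (convex hull C))"
proof (rule compact_complete_totally_bounded[OF assms(1)])
  show "totally_bounded (closure (convex hull C))"
    unfolding totally_bounded_def
  proof (intro allI impI)
    fix E :: "'a \<times> 'a \<Rightarrow> bool" assume "eventually E uniformity"
    then obtain U where U: "open U" "0 \<in> U" "\<And>x y. y - x \<in> U \<Longrightarrow> E (x, y)"
      by (rule eventually_uniformity_nhd_0) blast
    obtain V where V: "open V" "convex V" "0 \<in> V" "V \<subseteq> U" "\<And>x. x \<in> V \<Longrightarrow> - x \<in> V"
      using symmetric_convex_nhd_0[OF U(1,2)] by blast
    define W where "W = {x. 3 *\<^sub>R x \<in> V}"
    have "open ((\<lambda>x. 3 *\<^sub>R x) -` V)"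
      by (intro open_vimage V continuous_intros)
    then have oW: "open W" by (simp add: W_def vimage_def)
    have cW: "convex W"
    proof (rule convexI)
      fix x y :: 'a and u v :: real assume "x \<in> W" "y \<in> W" "0 \<le> u" "0 \<le> v" "u + v = 1"
      then have "u *\<^sub>R (3 *\<^sub>R x) + v *\<^sub>R (3 *\<^sub>R y) \<in> V"
        by (intro convexD[OF V(2)]) (auto simp: W_def)
      then show "u *\<^sub>R x + v *\<^sub>R y \<in> W"
        by (simp add: W_def scaleR_add_right mult.commute)
    qed
    have W: "0 \<in> W" "\<And>x. x \<in> W \<Longrightarrow> - x \<in> W" using V by (auto simp: W_def)
    have W3: "x + y + z \<in> V" if "x \<in> W" "y \<in> W" "z \<in> W" for x y z
    proof -
      have "(1/3) *\<^sub>R (3 *\<^sub>R x) + (2/3) *\<^sub>R ((1/2) *\<^sub>R (3 *\<^sub>R y) + (1/2) *\<^sub>R (3 *\<^sub>R z)) \<in> V"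
        using that by (intro convexD[OF V(2)]) (auto simp: W_def)
      then show ?thesis by (simp add: scaleR_add_right add.assoc)
    qed
    have open_shift: "open {y. y - x \<in> W}" for x
    proof -
      have "open ((\<lambda>y. y - x) -` W)" by (intro open_vimage oW continuous_intros)
      then show ?thesis by (simp add: vimage_def)
    qed
    have cover: "\<exists>F. finite F \<and> (\<forall>y\<in>K. \<exists>x\<in>F. y - x \<in> W)" if "compact K" for K
    proof -
      have "K \<subseteq> (\<Union>x\<in>K. {y. y - x \<in> W})" using W(1) by auto
      then show ?thesis by (rule compactE_image[OF that open_shift]) blast
    qed
    obtain F where F: "finite F" "\<forall>y\<in>C. \<exists>x\<in>F. y - x \<in> W" using cover[OF assms(2)] by blast
    obtain X where X: "finite X" "\<forall>y\<in>convex hull F. \<exists>x\<in>X. y - x \<in> W"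
      using cover[OF compact_convex_hull_finite[OF F(1)]] by blast
    have "convex hull C \<subseteq> {a + b |a b. a \<in> convex hull F \<and> b \<in> W}" (is "_ \<subseteq> ?R")
    proof (rule hull_minimal)
      have "?R = (\<Union>a\<in>convex hull F. \<Union>b\<in>W. {a + b})" by auto
      then show "convex ?R" using convex_sums[OF convex_convex_hull cW] by simp
      show "C \<subseteq> ?R"
      proof
        fix y assume "y \<in> C"
        then obtain x where "x \<in> F" "y - x \<in> W" using F by blast
        moreover have "y = x + (y - x)" by simp
        ultimately show "y \<in> ?R" using hull_inc[of x F convex] by blast
      qed
    qed
    note hull = this
    have "\<exists>x\<in>X. E (x, y)" if y: "y \<in> closure (convex hull C)" for y
    proof -
      have "{z. z - y \<in> W} \<inter> convex hull C \<noteq> {}"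
      proof -
        have "y \<in> {z. z - y \<in> W} \<inter> closure (convex hull C)" using y W(1) by simp
        then show ?thesis
          using open_Int_closure_eq_empty[OF open_shift[of y], of "convex hull C"] by blast
      qed
      then obtain z where z: "z - y \<in> W" "z \<in> convex hull C" by auto
      then obtain a b where ab: "z = a + b" "a \<in> convex hull F" "b \<in> W" using hull by blast
      then obtain x where x: "x \<in> X" "a - x \<in> W" using X by blast
      have "- (z - y) + b + (a - x) \<in> V" using W3 W(2) z(1) ab(3) x(2) by blast
      then have "y - x \<in> V" by (simp add: ab(1) algebra_simps)
      then show ?thesis using x(1) U V(4) by blast
    qed
    then show "\<exists>X. finite X \<and> (\<forall>s\<in>closure (convex hull C). \<exists>x\<in>X. E (x, s))"
      using X(1) by blast
  qed
qed simp

section \<open>Concave measures and compact sets\<close>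

instance real :: locally_convex_space
proof
  fix c x :: real
  show "((\<lambda>p. fst p *\<^sub>R snd p) \<longlongrightarrow> c *\<^sub>R x) (nhds c \<times>\<^sub>F nhds x)"
    by (intro tendsto_intros filterlim_fst filterlim_snd)
next
  fix U :: "real set" assume "open U" "0 \<in> U"
  then obtain e where e: "0 < e" "ball 0 e \<subseteq> U" by (auto simp: open_contains_ball)
  then show "\<exists>V. open V \<and> (\<forall>x\<in>V. \<forall>y\<in>V. \<forall>s\<ge>0. \<forall>t\<ge>0. s + t = 1 \<longrightarrow> s *\<^sub>R x + t *\<^sub>R y \<in> V) \<and> 0 \<in> V \<and> V \<subseteq> U"
    using convex_ball[of "0::real" e] by (intro exI[of _ "ball 0 e"]) (auto simp: convex_def)
qed

text \<open>
  The mean for positive finite arguments, where every power is the ordinary real one.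
\<close>

definition real_power_mean :: "ereal \<Rightarrow> real \<Rightarrow> real \<Rightarrow> real \<Rightarrow> real" where
  "real_power_mean \<alpha> t x y =
     (if \<alpha> = -\<infinity> then min x y
      else if \<alpha> = \<infinity> then max x y
      else if \<alpha> = 0 then x powr (1 - t) * y powr t
      else ((1 - t) * x powr real_of_ereal \<alpha> + t * y powr real_of_ereal \<alpha>) powr (1 / real_of_ereal \<alpha>))"

lemma ennreal_powr_ennreal: "0 < x \<Longrightarrow> ennreal_powr (ennreal x) p = ennreal (x powr p)"
  by (simp add: ennreal_powr_def)

lemma convex_combination_pos:
  fixes x y t :: real
  assumes "0 < t" "t < 1" "0 < x" "0 < y"
  shows "0 < (1 - t) * x + t * y"
  using assms by (intro add_pos_pos mult_pos_pos) auto

lemma power_mean_ennreal: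
  assumes "0 < t" "t < 1" "0 < x" "0 < y"
  shows "power_mean \<alpha> t (ennreal x) (ennreal y) = ennreal (real_power_mean \<alpha> t x y)"
proof -
  have "ennreal (1 - t) * ennreal (x powr a) + ennreal t * ennreal (y powr a)
      = ennreal ((1 - t) * x powr a + t * y powr a)" for a
    using assms by (simp add: ennreal_mult' ennreal_plus)
  then have "ennreal_powr (ennreal (1 - t) * ennreal_powr (ennreal x) a + ennreal t * ennreal_powr (ennreal y) a) (1 / a)
      = ennreal (((1 - t) * x powr a + t * y powr a) powr (1 / a))" for a
    using assms by (simp add: ennreal_powr_ennreal convex_combination_pos del: ennreal_plus)
  moreover have "ennreal_powr (ennreal x) (1 - t) * ennreal_powr (ennreal y) t = ennreal (x powr (1 - t) * y powr t)"
    using assms by (simp add: ennreal_powr_ennreal ennreal_mult)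
  moreover have "min (ennreal x) (ennreal y) = ennreal (min x y)" "max (ennreal x) (ennreal y) = ennreal (max x y)"
    using assms by (auto simp: min_def max_def)
  ultimately show ?thesis
    unfolding power_mean_def real_power_mean_def by (simp only: if_distrib[of ennreal])
qed

lemma real_power_mean_mono:
  assumes "0 < t" "t < 1" "0 < x" "x \<le> x'" "0 < y" "y \<le> y'"
  shows "real_power_mean \<alpha> t x y \<le> real_power_mean \<alpha> t x' y'"
proof -
  have "((1 - t) * x powr a + t * y powr a) powr (1 / a) \<le> ((1 - t) * x' powr a + t * y' powr a) powr (1 / a)"
    for a :: real
  proof (cases "0 \<le> a")
    case True
    then show ?thesis
      using assms by (intro powr_mono2 add_mono mult_left_mono) auto
  next
    case False
    then show ?thesis
      using assms by (intro powr_mono2' add_mono mult_left_mono convex_combination_pos) auto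
  qed
  moreover have "x powr (1 - t) * y powr t \<le> x' powr (1 - t) * y' powr t"
    using assms by (intro mult_mono powr_mono2) auto
  ultimately show ?thesis
    using assms unfolding real_power_mean_def by (auto simp: min_def max_def)
qed

lemma real_power_mean_idem:
  assumes "0 < x" "0 < t" "t < 1"
  shows "real_power_mean \<alpha> t x x = x"
proof -
  have "((1 - t) * x powr a + t * x powr a) powr (1 / a) = x" if "a \<noteq> 0" for a
    using assms that by (simp add: algebra_simps powr_powr)
  moreover have "x powr (1 - t) * x powr t = x"
    using assms by (simp add: powr_add[symmetric])
  moreover have "real_of_ereal \<alpha> \<noteq> 0" if "\<alpha> \<noteq> 0" "\<alpha> \<noteq> \<infinity>" "\<alpha> \<noteq> -\<infinity>"
    using that by (cases \<alpha>) auto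
  ultimately show ?thesis unfolding real_power_mean_def by auto
qed

lemma real_power_mean_ge_min:
  assumes "0 < t" "t < 1" "0 < x" "0 < y"
  shows "min x y \<le> real_power_mean \<alpha> t x y"
  using real_power_mean_mono[of t "min x y" x "min x y" y \<alpha>] real_power_mean_idem[of "min x y" t \<alpha>] assms
  by auto

text \<open>
  Together with monotonicity, homogeneity replaces continuity of the mean in all approximation
  arguments below: the arguments are shrunk by a factor \<open>r < 1\<close>, and \<open>r\<close> tends to 1.
\<close>

lemma real_power_mean_scale:
  assumes "0 < c" "0 < x" "0 < y" "0 < t" "t < 1"
  shows "real_power_mean \<alpha> t (c * x) (c * y) = c * real_power_mean \<alpha> t x y"
proof -
  have "((1 - t) * (c * x) powr a + t * (c * y) powr a) powr (1 / a)
      = c * ((1 - t) * x powr a + t * y powr a) powr (1 / a)" if "a \<noteq> 0" for a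
  proof -
    have "(1 - t) * (c * x) powr a + t * (c * y) powr a = c powr a * ((1 - t) * x powr a + t * y powr a)"
      using assms by (simp add: powr_mult algebra_simps)
    then show ?thesis
      using assms that by (simp add: powr_mult powr_powr convex_combination_pos less_imp_le)
  qed
  moreover have "(c * x) powr (1 - t) * (c * y) powr t = c * (x powr (1 - t) * y powr t)"
  proof -
    have "c powr (1 - t) * c powr t = c" using assms by (simp add: powr_add[symmetric])
    then show ?thesis using assms by (simp add: powr_mult algebra_simps)
  qed
  moreover have "real_of_ereal \<alpha> \<noteq> 0" if "\<alpha> \<noteq> 0" "\<alpha> \<noteq> \<infinity>" "\<alpha> \<noteq> -\<infinity>"
    using that by (cases \<alpha>) auto
  ultimately show ?thesis
    using assms unfolding real_power_mean_def by (auto simp: min_mult_distrib_left max_mult_distrib_left)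
qed

abbreviation convex_sum_set :: "real \<Rightarrow> 'a::real_vector set \<Rightarrow> 'a set \<Rightarrow> 'a set" where
  "convex_sum_set t A B \<equiv> {(1 - t) *\<^sub>R x + t *\<^sub>R y |x y. x \<in> A \<and> y \<in> B}"

lemma compact_convex_sum_set:
  fixes A B :: "'a::locally_convex_space set"
  assumes "compact A" "compact B"
  shows "compact (convex_sum_set t A B)"
proof -
  have "convex_sum_set t A B = (\<lambda>p. (1 - t) *\<^sub>R fst p + t *\<^sub>R snd p) ` (A \<times> B)" by force
  then show ?thesis
    by (simp only:) (intro compact_continuous_image compact_Times assms continuous_intros)
qed

lemma borel_compact: "compact (A :: 'a::t2_space set) \<Longrightarrow> A \<in> sets borel"
  by (simp add: compact_imp_closed)

text \<open>
  Concavity tested on compact sets only. Convex combinations of compact sets are compact and so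
  measurable, which removes the inner measure; inner regularity makes this equivalent to
  \<open>alpha_concave\<close> for finite Radon measures.
\<close>

definition compact_concave :: "ereal \<Rightarrow> 'a::{real_vector, topological_space} measure \<Rightarrow> bool" where
  "compact_concave \<alpha> M \<longleftrightarrow>
     (\<forall>t A B. 0 < t \<longrightarrow> t < 1 \<longrightarrow> compact A \<longrightarrow> compact B \<longrightarrow> 0 < measure M A \<longrightarrow> 0 < measure M B \<longrightarrow>
        real_power_mean \<alpha> t (measure M A) (measure M B) \<le> measure M (convex_sum_set t A B))"

lemma compact_concaveD:
  "compact_concave \<alpha> M \<Longrightarrow> 0 < t \<Longrightarrow> t < 1 \<Longrightarrow> compact A \<Longrightarrow> compact B \<Longrightarrow>
     0 < measure M A \<Longrightarrow> 0 < measure M B \<Longrightarrow>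
     real_power_mean \<alpha> t (measure M A) (measure M B) \<le> measure M (convex_sum_set t A B)"
  by (auto simp: compact_concave_def)

lemma emeasure_le_inner_measure:
  "C \<in> sets M \<Longrightarrow> C \<subseteq> S \<Longrightarrow> emeasure M C \<le> inner_measure M S"
  unfolding inner_measure_def by (intro SUP_upper) auto

lemma inner_measure_eq: "S \<in> sets M \<Longrightarrow> inner_measure M S = emeasure M S"
  by (intro antisym emeasure_le_inner_measure)
     (auto simp: inner_measure_def intro!: SUP_least emeasure_mono)

lemma alpha_concave_imp_compact_concave:
  fixes M :: "'a::locally_convex_space measure"
  assumes "finite_measure M" "alpha_concave \<alpha> M"
  shows "compact_concave \<alpha> M"
  unfolding compact_concave_def
proof (intro allI impI)
  interpret finite_measure M by fact
  have sets: "sets M = sets borel" using assms(2) by (simp add: alpha_concave_def radon_measure_def)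
  fix t :: real and A B :: "'a set"
  assume *: "0 < t" "t < 1" "compact A" "compact B" "0 < measure M A" "0 < measure M B"
  have "power_mean \<alpha> t (emeasure M A) (emeasure M B) \<le> inner_measure M (convex_sum_set t A B)"
    using assms(2) * borel_compact unfolding alpha_concave_def by (auto simp: emeasure_eq_measure)
  also have "\<dots> = emeasure M (convex_sum_set t A B)"
    using compact_convex_sum_set[OF *(3,4)] by (intro inner_measure_eq) (simp add: sets borel_compact)
  finally show "real_power_mean \<alpha> t (measure M A) (measure M B) \<le> measure M (convex_sum_set t A B)"
    using * by (simp add: emeasure_eq_measure power_mean_ennreal)
qed

lemma radon_measure_inner_compact:
  assumes "finite_measure M" "radon_measure M" "A \<in> sets borel" "c < measure M A"
  obtains K where "compact K" "K \<in> sets borel" "K \<subseteq> A" "c < measure M K"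
proof (cases "c < 0")
  case True
  then show ?thesis using that[of "{}"] by auto
next
  case False
  interpret finite_measure M by fact
  have "ennreal c < emeasure M A"
    using assms(4) False by (simp add: emeasure_eq_measure ennreal_less_iff)
  also have "emeasure M A = (SUP K\<in>{K. compact K \<and> K \<in> sets borel \<and> K \<subseteq> A}. emeasure M K)"
    using assms(2,3) by (auto simp: radon_measure_def)
  finally obtain K where "compact K" "K \<in> sets borel" "K \<subseteq> A" "ennreal c < emeasure M K"
    by (auto simp: less_SUP_iff)
  then show ?thesis
    using that False by (auto simp: emeasure_eq_measure ennreal_less_iff)
qed

lemma compact_concave_imp_alpha_concave:
  fixes M :: "'a::locally_convex_space measure"
  assumes "finite_measure M" "radon_measure M" "compact_concave \<alpha> M"
  shows "alpha_concave \<alpha> M"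
  unfolding alpha_concave_def
proof (intro conjI allI impI assms(2))
  interpret finite_measure M by fact
  have sets: "sets M = sets borel" using assms(2) by (simp add: radon_measure_def)
  fix t :: real and A B :: "'a set"
  assume t: "0 < t" "t < 1" and A: "A \<in> sets borel" and B: "B \<in> sets borel"
    and "0 < emeasure M A" "0 < emeasure M B"
  then have pos: "0 < measure M A" "0 < measure M B" by (auto simp: emeasure_eq_measure)
  define c where "c = real_power_mean \<alpha> t (measure M A) (measure M B)"
  have "ennreal (r * c) \<le> inner_measure M (convex_sum_set t A B)" if r: "0 < r" "r < 1" for r
  proof -
    obtain A' where A': "compact A'" "A' \<in> sets borel" "A' \<subseteq> A" "r * measure M A < measure M A'"
      using radon_measure_inner_compact[OF assms(1,2) A, of "r * measure M A"] pos r by auto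
    obtain B' where B': "compact B'" "B' \<in> sets borel" "B' \<subseteq> B" "r * measure M B < measure M B'"
      using radon_measure_inner_compact[OF assms(1,2) B, of "r * measure M B"] pos r by auto
    have rpos: "0 < r * measure M A" "0 < r * measure M B" using r pos by auto
    have "r * c = real_power_mean \<alpha> t (r * measure M A) (r * measure M B)"
      using pos r t by (simp add: c_def real_power_mean_scale)
    also have "\<dots> \<le> real_power_mean \<alpha> t (measure M A') (measure M B')"
      using t rpos A' B' by (intro real_power_mean_mono) auto
    also have "\<dots> \<le> measure M (convex_sum_set t A' B')"
      using t rpos A' B' by (intro compact_concaveD[OF assms(3)]) auto
    finally have "ennreal (r * c) \<le> emeasure M (convex_sum_set t A' B')"
      by (simp add: emeasure_eq_measure ennreal_leI)
    also have "\<dots> \<le> inner_measure M (convex_sum_set t A B)"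
      using compact_convex_sum_set[OF A'(1) B'(1), of t] A'(3) B'(3)
      by (intro emeasure_le_inner_measure) (auto simp: sets borel_compact)
    finally show ?thesis .
  qed
  note * = this
  have "0 \<le> c" using real_power_mean_ge_min[OF t pos, of \<alpha>] pos by (auto simp: c_def)
  have "ennreal c \<le> inner_measure M (convex_sum_set t A B)"
  proof (cases "inner_measure M (convex_sum_set t A B)")
    case (real d)
    have "c \<le> d"
    proof (rule field_le_mult_one_interval)
      fix z :: real assume "0 < z" "z < 1"
      then show "z * c \<le> d" using *[of z] real by (simp add: ennreal_le_iff)
    qed
    then show ?thesis using real by (simp add: ennreal_leI)
  qed simp
  then show "power_mean \<alpha> t (emeasure M A) (emeasure M B) \<le> inner_measure M (convex_sum_set t A B)"
    using t pos by (simp add: emeasure_eq_measure power_mean_ennreal c_def)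
qed

lemma compact_concave_uniform_measure:
  fixes M :: "'a::locally_convex_space measure"
  assumes "finite_measure M" "sets M = sets borel" "compact_concave \<alpha> M"
    and K: "compact K" "convex K" "0 < measure M K"
  shows "compact_concave \<alpha> (uniform_measure M K)"
  unfolding compact_concave_def
proof (intro allI impI)
  interpret finite_measure M by fact
  have meas: "measure (uniform_measure M K) A = inverse (measure M K) * measure M (K \<inter> A)" if "compact A" for A
    using K that assms(2) by (subst measure_uniform_measure) (auto simp: emeasure_eq_measure borel_compact divide_inverse)
  fix t :: real and A B :: "'a set"
  assume t: "0 < t" "t < 1" and A: "compact A" and B: "compact B"
    and *: "0 < measure (uniform_measure M K) A" "0 < measure (uniform_measure M K) B"
  have cAB: "compact (K \<inter> A)" "compact (K \<inter> B)"
    using K(1) A B by (auto intro: compact_Int)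
  have pos: "0 < measure M (K \<inter> A)" "0 < measure M (K \<inter> B)"
    using * K(3) by (auto simp: meas A B zero_less_mult_iff)
  have "real_power_mean \<alpha> t (measure M (K \<inter> A)) (measure M (K \<inter> B)) \<le> measure M (convex_sum_set t (K \<inter> A) (K \<inter> B))"
    by (intro compact_concaveD[OF assms(3)] t cAB pos)
  also have "\<dots> \<le> measure M (K \<inter> convex_sum_set t A B)"
  proof (rule finite_measure_mono)
    show "convex_sum_set t (K \<inter> A) (K \<inter> B) \<subseteq> K \<inter> convex_sum_set t A B"
      using t convexD[OF K(2)] by fastforce
    show "K \<inter> convex_sum_set t A B \<in> sets M"
      unfolding assms(2) by (intro sets.Int borel_compact compact_convex_sum_set A B K)
  qed
  finally have "inverse (measure M K) * real_power_mean \<alpha> t (measure M (K \<inter> A)) (measure M (K \<inter> B))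
    \<le> inverse (measure M K) * measure M (K \<inter> convex_sum_set t A B)"
    using K(3) by (intro mult_left_mono) auto
  then show "real_power_mean \<alpha> t (measure (uniform_measure M K) A) (measure (uniform_measure M K) B)
      \<le> measure (uniform_measure M K) (convex_sum_set t A B)"
    using K(3) t pos by (simp add: meas A B compact_convex_sum_set real_power_mean_scale)
qed

text \<open>
  The preimage of a compact set need not be compact, but its intersection with a compact set \<open>K\<close>
  of full measure is.
\<close>

lemma compact_concave_distr:
  fixes M :: "'a::locally_convex_space measure" and T :: "'a \<Rightarrow> 'b::locally_convex_space"
  assumes "finite_measure M" "sets M = sets borel" "compact_concave \<alpha> M"
    and T: "continuous_on UNIV T" "\<And>x y t. T ((1 - t) *\<^sub>R x + t *\<^sub>R y) = (1 - t) *\<^sub>R T x + t *\<^sub>R T y"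
    and K: "compact K" "measure M (- K) = 0"
  shows "compact_concave \<alpha> (distr M borel T)"
  unfolding compact_concave_def
proof (intro allI impI)
  interpret finite_measure M by fact
  have space: "space M = UNIV" using sets_eq_imp_space_eq[OF assms(2)] by simp
  have Tm: "T \<in> measurable M borel"
    unfolding measurable_cong_sets[OF assms(2) refl] by (rule borel_measurable_continuous_onI[OF T(1)])
  have vim: "T -` A \<in> sets M" if "A \<in> sets borel" for A
    using measurable_sets[OF Tm that] space by simp
  have meas: "measure (distr M borel T) A = measure M (T -` A \<inter> K)" if A: "compact A" for A
  proof -
    have "measure (distr M borel T) A = measure M (T -` A)"
      using A Tm by (subst measure_distr) (auto simp: borel_compact space)
    also have "\<dots> = measure M (T -` A \<inter> K)"
    proof -
      have KM: "K \<in> sets M" by (simp add: assms(2) borel_compact K)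
      have "AE x in M. x \<in> K"
        using K(2) KM by (intro AE_I[of _ _ "- K"]) (auto simp: emeasure_eq_measure space Compl_eq_Diff_UNIV assms(2))
      then show ?thesis
        using KM vim[of A] A by (intro finite_measure_eq_AE) (auto simp: borel_compact)
    qed
    finally show ?thesis .
  qed
  have comp: "compact (T -` A \<inter> K)" if "compact A" for A
    using that K(1) T(1) by (intro closed_Int_compact closed_vimage compact_imp_closed)
  fix t :: real and A B :: "'b set"
  assume t: "0 < t" "t < 1" and A: "compact A" and B: "compact B"
    and *: "0 < measure (distr M borel T) A" "0 < measure (distr M borel T) B"
  let ?A = "T -` A \<inter> K" and ?B = "T -` B \<inter> K"
  have "real_power_mean \<alpha> t (measure M ?A) (measure M ?B) \<le> measure M (convex_sum_set t ?A ?B)"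
    using * by (intro compact_concaveD[OF assms(3)] t comp A B) (auto simp: meas A B)
  also have "\<dots> \<le> measure M (T -` convex_sum_set t A B)"
  proof (intro finite_measure_mono vim borel_compact compact_convex_sum_set A B)
    show "convex_sum_set t ?A ?B \<subseteq> T -` convex_sum_set t A B"
      using T(2) by blast
  qed
  also have "\<dots> = measure (distr M borel T) (convex_sum_set t A B)"
    using compact_convex_sum_set[OF A B, of t] Tm
    by (subst measure_distr) (auto simp: borel_compact space)
  finally show "real_power_mean \<alpha> t (measure (distr M borel T) A) (measure (distr M borel T) B)
    \<le> measure (distr M borel T) (convex_sum_set t A B)"
    by (simp add: meas A B)
qed

text \<open>
  If both the hyperplane and a set \<open>B\<close> strictly on one side of it had positive measure, then
  the convex combinations with weight \<open>t\<close> would have measure at least the minimum \<open>m\<close> of the two, for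
  every \<open>t\<close>. They lie in the slabs \<open>0 < h \<le> t * d\<close>, whose measure tends to 0 with \<open>t\<close>.
\<close>

lemma compact_concave_halfspace_null:
  fixes M :: "'a::locally_convex_space measure" and h :: "'a \<Rightarrow> real"
  assumes "finite_measure M" "sets M = sets borel" "compact_concave \<alpha> M"
    and K: "compact K" "convex K"
    and h: "continuous_on UNIV h" "\<And>x y t. h ((1 - t) *\<^sub>R x + t *\<^sub>R y) = (1 - t) * h x + t * h y"
    and pos: "0 < measure M (K \<inter> {x. h x = 0})"
  shows "measure M (K \<inter> {x. 0 < h x}) = 0"
proof (rule ccontr)
  interpret finite_measure M by fact
  have space: "space M = UNIV" using sets_eq_imp_space_eq[OF assms(2)] by simp
  have hm [measurable]: "h \<in> borel_measurable M"
    unfolding measurable_cong_sets[OF assms(2) refl] by (rule borel_measurable_continuous_onI[OF h(1)])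
  have KM [measurable]: "K \<in> sets M" by (simp add: assms(2) borel_compact K)
  have closed1: "closed {x. h x = 0}" and closed2: "closed {x. c \<le> h x}" for c
    using h(1) by (auto intro!: closed_Collect_eq closed_Collect_le continuous_on_const)
  assume "measure M (K \<inter> {x. 0 < h x}) \<noteq> 0"
  define B where "B n = K \<inter> {x. inverse (Suc n) \<le> h x}" for n :: nat
  have Bm: "B n \<in> sets M" for n
    unfolding B_def using closed2 KM by (simp add: assms(2))
  have "\<exists>n. 0 < measure M (B n)"
  proof (rule ccontr)
    assume "\<not> ?thesis"
    then have "emeasure M (B n) = 0" for n
      by (simp add: emeasure_eq_measure zero_less_measure_iff)
    then have "emeasure M (\<Union>n. B n) = 0"
      using Bm by (intro emeasure_UN_eq_0) auto
    moreover have "(\<Union>n. B n) = K \<inter> {x. 0 < h x}"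
    proof (intro equalityI subsetI)
      fix x assume "x \<in> (\<Union>n. B n)"
      then obtain k where "x \<in> K" "inverse (real (Suc k)) \<le> h x" by (auto simp: B_def)
      moreover have "0 < inverse (real (Suc k))" by simp
      ultimately show "x \<in> K \<inter> {x. 0 < h x}" using less_le_trans by blast
    next
      fix x assume x: "x \<in> K \<inter> {x. 0 < h x}"
      then obtain k where "inverse (real (Suc k)) < h x" using reals_Archimedean by blast
      then show "x \<in> (\<Union>n. B n)" using x by (auto simp: B_def intro!: exI[of _ k])
    qed
    ultimately show False using \<open>measure M (K \<inter> {x. 0 < h x}) \<noteq> 0\<close> by (simp add: measure_def)
  qed
  then obtain n where n: "0 < measure M (B n)" by blast
  have cB: "compact (B n)" and cH: "compact (K \<inter> {x. h x = 0})"
    unfolding B_def using K closed1 closed2 by (auto intro: compact_Int_closed)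
  define m where "m = min (measure M (K \<inter> {x. h x = 0})) (measure M (B n))"
  have m: "0 < m" using pos n by (simp add: m_def)
  have "bounded (h ` K)"
    using h(1) K(1) by (intro compact_imp_bounded compact_continuous_image) (auto intro: continuous_on_subset)
  then obtain d where d: "0 < d" "\<And>x. x \<in> K \<Longrightarrow> h x \<le> d"
    unfolding bounded_pos by (auto simp: abs_le_iff)
  define S where "S k = K \<inter> {x. 0 < h x \<and> h x \<le> d / real (k + 2)}" for k :: nat
  have Sm: "S k \<in> sets M" for k
  proof -
    have "S k = K \<inter> {x \<in> space M. 0 < h x \<and> h x \<le> d / real (k + 2)}" by (simp add: S_def space)
    then show ?thesis by simp
  qed
  have S: "m \<le> measure M (S k)" for k
  proof -
    let ?t = "1 / real (k + 2)"
    let ?C = "convex_sum_set ?t (K \<inter> {x. h x = 0}) (B n)"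
    have t: "0 < ?t" "?t < 1" by auto
    have "m \<le> real_power_mean \<alpha> ?t (measure M (K \<inter> {x. h x = 0})) (measure M (B n))"
      unfolding m_def by (rule real_power_mean_ge_min[OF t pos n])
    also have "\<dots> \<le> measure M ?C"
      by (rule compact_concaveD[OF assms(3) t cH cB pos n])
    also have "\<dots> \<le> measure M (S k)"
    proof (rule finite_measure_mono)
      show "?C \<subseteq> S k"
      proof
        fix z assume "z \<in> ?C"
        then obtain x y where z: "z = (1 - ?t) *\<^sub>R x + ?t *\<^sub>R y" and x: "x \<in> K" "h x = 0" and y: "y \<in> B n"
          by auto
        have "z \<in> K" unfolding z using t x y by (intro convexD[OF K(2)]) (auto simp: B_def)
        moreover have "h z = ?t * h y" unfolding z h(2) using x by simp
        moreover have "0 < h y" using y less_le_trans[of 0 "inverse (real (Suc n))" "h y"] by (simp add: B_def)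
        moreover have "h y \<le> d" using y d by (auto simp: B_def)
        ultimately show "z \<in> S k" by (auto simp: S_def divide_right_mono)
      qed
    qed (rule Sm)
    finally show ?thesis .
  qed
  have "(\<lambda>k. measure M (S k)) \<longlonglongrightarrow> measure M (\<Inter>k. S k)"
  proof (rule finite_Lim_measure_decseq)
    show "range S \<subseteq> sets M" using Sm by auto
    have "d / real (Suc k + 2) \<le> d / real (k + 2)" for k
      using d(1) by (intro divide_left_mono) auto
    then show "decseq S"
      unfolding decseq_Suc_iff S_def by (auto intro: order_trans)
  qed
  moreover have "(\<Inter>k. S k) = {}"
  proof -
    have False if x: "\<And>k. x \<in> S k" for x
    proof -
      have "0 < h x" using x[of 0] by (simp add: S_def)
      then obtain k where "d / h x < real k" using reals_Archimedean2 by blast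
      then have "d < h x * real (k + 2)" using \<open>0 < h x\<close> by (simp add: field_simps)
      then show False using x[of k] by (simp add: S_def field_simps)
    qed
    then show ?thesis by blast
  qed
  ultimately have "m \<le> 0" using S by (intro LIMSEQ_le_const) auto
  then show False using m by simp
qed

theorem compact_concave_hyperplane_zero_one:
  fixes M :: "'a::locally_convex_space measure" and h :: "'a \<Rightarrow> real"
  assumes "finite_measure M" "sets M = sets borel" "compact_concave \<alpha> M"
    and K: "compact K" "convex K"
    and h: "continuous_on UNIV h" "\<And>x y t. h ((1 - t) *\<^sub>R x + t *\<^sub>R y) = (1 - t) * h x + t * h y"
    and pos: "0 < measure M (K \<inter> {x. h x = 0})"
  shows "AE x in M. x \<in> K \<longrightarrow> h x = 0"
proof -
  interpret finite_measure M by fact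
  have space: "space M = UNIV" using sets_eq_imp_space_eq[OF assms(2)] by simp
  have hm [measurable]: "h \<in> borel_measurable M"
    unfolding measurable_cong_sets[OF assms(2) refl] by (rule borel_measurable_continuous_onI[OF h(1)])
  have KM [measurable]: "K \<in> sets M" by (simp add: assms(2) borel_compact K)
  have "measure M (K \<inter> {x. 0 < h x}) = 0"
    by (rule compact_concave_halfspace_null[OF assms(1-5) h pos])
  moreover have "measure M (K \<inter> {x. 0 < - h x}) = 0"
    using h pos
    by (intro compact_concave_halfspace_null[OF assms(1-5)] continuous_intros) (auto simp: algebra_simps)
  moreover have "K \<inter> {x \<in> space M. 0 < h x} \<in> sets M" "K \<inter> {x \<in> space M. 0 < - h x} \<in> sets M"
    by measurable
  ultimately have "K \<inter> {x. 0 < h x} \<in> null_sets M" "K \<inter> {x. 0 < - h x} \<in> null_sets M"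
    by (simp_all add: space null_sets_def emeasure_eq_measure)
  then have "AE x in M. x \<notin> K \<inter> {x. 0 < h x}" "AE x in M. x \<notin> K \<inter> {x. 0 < - h x}"
    by (simp_all add: AE_not_in del: Int_iff)
  then show ?thesis by eventually_elim auto
qed

section \<open>Weak limits of concave measures on the real line\<close>

context
  fixes \<pi> :: "nat \<Rightarrow> real measure" and M :: "real measure"
  assumes \<pi>: "\<And>n. real_distribution (\<pi> n)" and M: "real_distribution M"
    and weak: "weak_conv_m \<pi> M"
begin

interpretation \<pi>: real_distribution "\<pi> n" for n by (rule \<pi>)
interpretation M: real_distribution M by (rule M)

text \<open>
  The indicators of the two thickenings are separated by a continuous function.
\<close>

lemma weak_limit_closed_thickening:
  assumes C: "C \<noteq> {}" and \<delta>: "0 < \<delta>"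
    and c: "\<forall>\<^sub>F n in sequentially. c \<le> measure (\<pi> n) {x. infdist x C \<le> \<delta>}"
  shows "c \<le> measure M {x. infdist x C \<le> 2 * \<delta>}"
proof -
  define \<psi> where "\<psi> x = max 0 (min 1 (2 - infdist x C / \<delta>))" for x :: real
  have cont: "continuous_on UNIV \<psi>"
    unfolding \<psi>_def using \<delta> by (intro continuous_intros) auto
  have bdd: "0 \<le> \<psi> x" "\<psi> x \<le> 1" for x by (auto simp: \<psi>_def)
  have [measurable]: "\<psi> \<in> borel_measurable borel" by (rule borel_measurable_continuous_onI[OF cont])
  have int: "integrable (\<pi> n) \<psi>" for n
    by (rule \<pi>.integrable_const_bound[of _ 1]) (use bdd in auto)
  have intM: "integrable M \<psi>"
    by (rule M.integrable_const_bound[of _ 1]) (use bdd in auto)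
  have closed: "closed {x. infdist x C \<le> e}" for e
    by (intro closed_Collect_le continuous_intros)
  have "(\<lambda>n. integral\<^sup>L (\<pi> n) \<psi>) \<longlonglongrightarrow> integral\<^sup>L M \<psi>"
    using bdd cont
    by (intro weak_conv_imp_integral_bdd_continuous_conv[OF \<pi> M weak, of _ 1])
       (auto simp: continuous_on_eq_continuous_at)
  moreover have "\<forall>\<^sub>F n in sequentially. c \<le> integral\<^sup>L (\<pi> n) \<psi>"
    using c
  proof eventually_elim
    fix n assume "c \<le> measure (\<pi> n) {x. infdist x C \<le> \<delta>}"
    also have "\<dots> = integral\<^sup>L (\<pi> n) (indicator {x. infdist x C \<le> \<delta>})"
      using closed by simp
    also have "\<dots> \<le> integral\<^sup>L (\<pi> n) \<psi>"
      using closed \<delta> int bdd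
      by (intro integral_mono) (auto simp: \<psi>_def field_simps split: split_indicator intro!: integrable_real_indicator simp: less_top[symmetric])
    finally show "c \<le> integral\<^sup>L (\<pi> n) \<psi>" .
  qed
  ultimately have "c \<le> integral\<^sup>L M \<psi>"
    by (rule tendsto_lowerbound) simp
  also have "\<dots> \<le> integral\<^sup>L M (indicator {x. infdist x C \<le> 2 * \<delta>})"
    using closed \<delta> intM bdd
    by (intro integral_mono) (auto simp: \<psi>_def field_simps split: split_indicator intro!: integrable_real_indicator simp: less_top[symmetric])
  also have "\<dots> = measure M {x. infdist x C \<le> 2 * \<delta>}"
    using closed by simp
  finally show ?thesis .
qed

lemma weak_limit_closed:
  assumes C: "closed C" "C \<noteq> {}"
    and c: "\<And>\<delta>. 0 < \<delta> \<Longrightarrow> \<forall>\<^sub>F n in sequentially. c \<le> measure (\<pi> n) {x. infdist x C \<le> \<delta>}"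
  shows "c \<le> measure M C"
proof -
  define S where "S k = {x. infdist x C \<le> 2 * inverse (real (Suc k))}" for k
  have S: "c \<le> measure M (S k)" for k
    unfolding S_def by (intro weak_limit_closed_thickening C c) simp_all
  have closed: "closed (S k)" for k
    unfolding S_def by (intro closed_Collect_le continuous_intros)
  have "(\<lambda>k. measure M (S k)) \<longlonglongrightarrow> measure M (\<Inter>k. S k)"
  proof (rule M.finite_Lim_measure_decseq)
    show "range S \<subseteq> sets M" using closed by auto
    have "inverse (real (Suc (Suc k))) \<le> inverse (real (Suc k))" for k
      by (intro le_imp_inverse_le) auto
    then show "decseq S"
      unfolding decseq_Suc_iff S_def by (force intro: order_trans)
  qed
  moreover have "(\<Inter>k. S k) = C"
  proof (intro equalityI subsetI)
    fix x assume "x \<in> (\<Inter>k. S k)"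
    then have x: "infdist x C \<le> 2 * inverse (real (Suc k))" for k by (auto simp: S_def)
    have "(\<lambda>k. 2 * inverse (real (Suc k))) \<longlonglongrightarrow> 2 * 0"
      by (intro tendsto_mult tendsto_const LIMSEQ_inverse_real_of_nat)
    then have "infdist x C \<le> 2 * 0"
      by (rule LIMSEQ_le_const) (use x in blast)
    then have "infdist x C \<le> 0" by simp
    then show "x \<in> C"
      using C infdist_nonneg[of x C] in_closed_iff_infdist_zero[of C x] by auto
  next
    fix x assume "x \<in> C"
    then have "infdist x C = 0" using C by (simp add: in_closed_iff_infdist_zero[symmetric])
    then show "x \<in> (\<Inter>k. S k)" by (simp add: S_def)
  qed
  ultimately show ?thesis using S by (intro LIMSEQ_le_const) auto
qed

lemma weak_limit_thickening_lower:
  assumes A: "closed A" "A \<noteq> {}" and \<delta>: "0 < \<delta>" and c: "c < measure M A"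
  shows "\<forall>\<^sub>F n in sequentially. c < measure (\<pi> n) {x. infdist x A \<le> \<delta>}"
proof -
  define \<psi> where "\<psi> x = max 0 (1 - infdist x A / \<delta>)" for x :: real
  have cont: "continuous_on UNIV \<psi>"
    unfolding \<psi>_def using \<delta> by (intro continuous_intros) auto
  have bdd: "0 \<le> \<psi> x" "\<psi> x \<le> 1" for x
    using \<delta> infdist_nonneg[of x A] by (auto simp: \<psi>_def)
  have [measurable]: "\<psi> \<in> borel_measurable borel" by (rule borel_measurable_continuous_onI[OF cont])
  have int: "integrable (\<pi> n) \<psi>" for n
    by (rule \<pi>.integrable_const_bound[of _ 1]) (use bdd in auto)
  have intM: "integrable M \<psi>"
    by (rule M.integrable_const_bound[of _ 1]) (use bdd in auto)
  have closed: "closed {x. infdist x A \<le> \<delta>}"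
    by (intro closed_Collect_le continuous_intros)
  have "c < integral\<^sup>L M (indicator A)" using c A by simp
  also have "\<dots> \<le> integral\<^sup>L M \<psi>"
    using A \<delta> intM bdd
    by (intro integral_mono) (auto simp: \<psi>_def split: split_indicator intro!: integrable_real_indicator simp: less_top[symmetric])
  finally have "c < integral\<^sup>L M \<psi>" .
  moreover have "(\<lambda>n. integral\<^sup>L (\<pi> n) \<psi>) \<longlonglongrightarrow> integral\<^sup>L M \<psi>"
    using bdd cont
    by (intro weak_conv_imp_integral_bdd_continuous_conv[OF \<pi> M weak, of _ 1])
       (auto simp: continuous_on_eq_continuous_at)
  ultimately have "\<forall>\<^sub>F n in sequentially. c < integral\<^sup>L (\<pi> n) \<psi>"
    by (intro order_tendstoD)
  then show ?thesis
  proof eventually_elim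
    fix n assume "c < integral\<^sup>L (\<pi> n) \<psi>"
    also have "\<dots> \<le> integral\<^sup>L (\<pi> n) (indicator {x. infdist x A \<le> \<delta>})"
      using closed \<delta> int bdd
      by (intro integral_mono) (auto simp: \<psi>_def field_simps split: split_indicator intro!: integrable_real_indicator simp: less_top[symmetric])
    also have "\<dots> = measure (\<pi> n) {x. infdist x A \<le> \<delta>}"
      using closed by simp
    finally show "c < measure (\<pi> n) {x. infdist x A \<le> \<delta>}" .
  qed
qed

text \<open>
  Neighbourhoods of \<open>A\<close> and \<open>B\<close> have asymptotically at least the limit measures of \<open>A\<close> and \<open>B\<close>, and
  their convex combination stays in a neighbourhood of the convex combination of \<open>A\<close> and \<open>B\<close>, whose
  measure is asymptotically at most that of a larger neighbourhood.
\<close>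

theorem compact_concave_weak_limit:
  assumes conc: "\<And>n. compact_concave \<alpha> (\<pi> n)"
  shows "compact_concave \<alpha> M"
  unfolding compact_concave_def
proof (intro allI impI)
  fix t :: real and A B :: "real set"
  assume t: "0 < t" "t < 1" and A: "compact A" "0 < measure M A" and B: "compact B" "0 < measure M B"
  have ne: "A \<noteq> {}" "B \<noteq> {}" using A B by auto
  let ?C = "convex_sum_set t A B"
  let ?T = "\<lambda>S \<delta>. {x. infdist x S \<le> \<delta>}"
  have C: "closed ?C" "?C \<noteq> {}"
    using compact_convex_sum_set[OF A(1) B(1), of t] ne by (auto intro: compact_imp_closed)
  have incl: "convex_sum_set t (?T A \<delta>) (?T B \<delta>) \<subseteq> ?T ?C \<delta>" if "0 < \<delta>" for \<delta>
  proof
    fix z assume "z \<in> convex_sum_set t (?T A \<delta>) (?T B \<delta>)"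
    then obtain x y where z: "z = (1 - t) *\<^sub>R x + t *\<^sub>R y" and xy: "infdist x A \<le> \<delta>" "infdist y B \<le> \<delta>"
      by auto
    obtain a where a: "a \<in> A" "dist x a \<le> \<delta>"
      using infdist_attains_inf[OF compact_imp_closed[OF A(1)] ne(1), of x] xy(1) by metis
    obtain b where b: "b \<in> B" "dist y b \<le> \<delta>"
      using infdist_attains_inf[OF compact_imp_closed[OF B(1)] ne(2), of y] xy(2) by metis
    let ?c = "(1 - t) *\<^sub>R a + t *\<^sub>R b"
    have "\<bar>z - ?c\<bar> = \<bar>(1 - t) * (x - a) + t * (y - b)\<bar>" by (simp add: z algebra_simps)
    also have "\<dots> \<le> (1 - t) * \<bar>x - a\<bar> + t * \<bar>y - b\<bar>"
      using t abs_triangle_ineq[of "(1 - t) * (x - a)" "t * (y - b)"] by (simp add: abs_mult)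
    also have "\<dots> \<le> (1 - t) * \<delta> + t * \<delta>"
      using t a b by (intro add_mono mult_left_mono) (auto simp: dist_real_def)
    finally have "dist z ?c \<le> \<delta>" by (simp add: dist_real_def algebra_simps)
    moreover have "?c \<in> ?C" using a b by blast
    ultimately show "z \<in> ?T ?C \<delta>" using infdist_le2[of ?c ?C z \<delta>] by auto
  qed
  show "real_power_mean \<alpha> t (measure M A) (measure M B) \<le> measure M ?C"
  proof (rule field_le_mult_one_interval)
    fix r :: real assume r: "0 < r" "r < 1"
    show "r * real_power_mean \<alpha> t (measure M A) (measure M B) \<le> measure M ?C"
    proof (rule weak_limit_closed[OF C])
      fix \<delta> :: real assume \<delta>: "0 < \<delta>"
      have "\<forall>\<^sub>F n in sequentially. r * measure M A < measure (\<pi> n) (?T A \<delta>)"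
        using r A ne \<delta> by (intro weak_limit_thickening_lower compact_imp_closed) auto
      moreover have "\<forall>\<^sub>F n in sequentially. r * measure M B < measure (\<pi> n) (?T B \<delta>)"
        using r B ne \<delta> by (intro weak_limit_thickening_lower compact_imp_closed) auto
      ultimately show "\<forall>\<^sub>F n in sequentially.
          r * real_power_mean \<alpha> t (measure M A) (measure M B) \<le> measure (\<pi> n) (?T ?C \<delta>)"
      proof eventually_elim
        fix n assume n: "r * measure M A < measure (\<pi> n) (?T A \<delta>)" "r * measure M B < measure (\<pi> n) (?T B \<delta>)"
        have rpos: "0 < r * measure M A" "0 < r * measure M B" using r A B by auto
        have "r * real_power_mean \<alpha> t (measure M A) (measure M B)
            = real_power_mean \<alpha> t (r * measure M A) (r * measure M B)"
          using r A B t by (simp add: real_power_mean_scale)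
        also have "\<dots> \<le> real_power_mean \<alpha> t (measure (\<pi> n) (?T A \<delta>)) (measure (\<pi> n) (?T B \<delta>))"
          using t rpos n by (intro real_power_mean_mono) auto
        also have "\<dots> \<le> measure (\<pi> n) (convex_sum_set t (?T A \<delta>) (?T B \<delta>))"
          using t rpos n A B ne \<delta> by (intro compact_concaveD[OF conc] compact_infdist_le) auto
        also have "\<dots> \<le> measure (\<pi> n) (?T ?C \<delta>)"
          by (intro \<pi>.finite_measure_mono incl \<delta>) (auto intro!: borel_closed closed_Collect_le continuous_intros)
        finally show "r * real_power_mean \<alpha> t (measure M A) (measure M B) \<le> measure (\<pi> n) (?T ?C \<delta>)" .
      qed
    qed
  qed
qed

end

section \<open>Halving one integral while keeping another positive\<close>

lemma measurable_halfspace_indicator [measurable]: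
  fixes h :: "'a \<Rightarrow> real"
  assumes [measurable]: "h \<in> borel_measurable M"
  shows "(\<lambda>x. indicator {x. 0 \<le> h x} x :: real) \<in> borel_measurable M"
proof -
  have "(\<lambda>x. indicator {x. 0 \<le> h x} x :: real) = (\<lambda>x. indicator {0..} (h x))"
    by (simp add: indicator_def)
  then show ?thesis by simp
qed

text \<open>
  The half-planes are \<open>c * h1 + d * h2 \<ge> 0\<close>. If some boundary line has full measure, the half-plane it
  bounds loses nothing. Otherwise all boundary lines are null, the integral of \<open>f\<close> over the half-plane in
  direction \<open>\<theta>\<close> is continuous in \<open>\<theta>\<close>, and it agrees with that over the opposite half-plane for some
  \<open>\<theta>\<close> by the intermediate value theorem. Both then carry half of the integral of \<open>f\<close>, and one of them a
  positive integral of \<open>g\<close>.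
\<close>

lemma halfplane_bisection:
  fixes M :: "'a measure" and h1 h2 f g :: "'a \<Rightarrow> real"
  assumes f: "integrable M f" "0 < integral\<^sup>L M f" "\<And>x. x \<notin> K \<Longrightarrow> f x = 0"
    and g: "integrable M g" "0 < integral\<^sup>L M g" "\<And>x. x \<notin> K \<Longrightarrow> g x = 0"
    and [measurable]: "h1 \<in> borel_measurable M" "h2 \<in> borel_measurable M"
    and zero_one: "\<And>c d. (c, d) \<noteq> (0, 0) \<Longrightarrow>
      (AE x in M. x \<in> K \<longrightarrow> c * h1 x + d * h2 x = 0) \<or> (AE x in M. x \<in> K \<longrightarrow> c * h1 x + d * h2 x \<noteq> 0)"
  shows "\<exists>c d. (c, d) \<noteq> (0, 0) \<and>
     0 < (\<integral>x. indicator {x. 0 \<le> c * h1 x + d * h2 x} x * f x \<partial>M) \<and>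
     0 < (\<integral>x. indicator {x. 0 \<le> c * h1 x + d * h2 x} x * g x \<partial>M)"
proof (cases "\<exists>c d. (c, d) \<noteq> (0, 0) \<and> (AE x in M. x \<in> K \<longrightarrow> c * h1 x + d * h2 x = 0)")
  case True
  then obtain c d where cd: "(c, d) \<noteq> (0, 0)" and ae: "AE x in M. x \<in> K \<longrightarrow> c * h1 x + d * h2 x = 0" by blast
  have "(\<integral>x. indicator {x. 0 \<le> c * h1 x + d * h2 x} x * F x \<partial>M) = integral\<^sup>L M F"
    if F: "integrable M F" "\<And>x. x \<notin> K \<Longrightarrow> F x = 0" for F :: "'a \<Rightarrow> real"
  proof (rule integral_cong_AE)
    have [measurable]: "F \<in> borel_measurable M" using F by auto
    show "(\<lambda>x. indicator {x. 0 \<le> c * h1 x + d * h2 x} x * F x) \<in> borel_measurable M"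
      by (intro borel_measurable_times measurable_halfspace_indicator) measurable
    show "AE x in M. indicator {x. 0 \<le> c * h1 x + d * h2 x} x * F x = F x"
      using ae by eventually_elim (use F(2) in \<open>auto split: split_indicator\<close>)
  qed (use F in auto)
  then show ?thesis using cd f g by (intro exI[of _ c] exI[of _ d]) simp
next
  case False
  define w where "w \<theta> x = cos \<theta> * h1 x + sin \<theta> * h2 x" for \<theta> x
  have cs: "(cos \<theta>, sin \<theta>) \<noteq> (0, 0)" for \<theta> :: real
  proof
    assume "(cos \<theta>, sin \<theta>) = (0, 0)"
    then show False using sin_cos_squared_add[of \<theta>] by (simp del: sin_cos_squared_add)
  qed
  have ae: "AE x in M. x \<in> K \<longrightarrow> w \<theta> x \<noteq> 0" for \<theta>
    unfolding w_def using False zero_one[OF cs[of \<theta>]] cs[of \<theta>] by blast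
  have [measurable]: "w \<theta> \<in> borel_measurable M" for \<theta> unfolding w_def by measurable
  define \<psi> where "\<psi> F \<theta> = (\<integral>x. indicator {x. 0 \<le> w \<theta> x} x * F x \<partial>M)" for F :: "'a \<Rightarrow> real" and \<theta>
  have integ: "integrable M (\<lambda>x. indicator {x. 0 \<le> w \<theta> x} x * F x)" if F: "integrable M F" for F :: "'a \<Rightarrow> real" and \<theta>
  proof (rule Bochner_Integration.integrable_bound[OF F])
    show "(\<lambda>x. indicator {x. 0 \<le> w \<theta> x} x * F x) \<in> borel_measurable M"
      using borel_measurable_integrable[OF F]
      by (intro borel_measurable_times measurable_halfspace_indicator) measurable
  qed (auto split: split_indicator)
  have antipodal: "\<psi> F \<theta> + \<psi> F (\<theta> + pi) = integral\<^sup>L M F"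
    if F: "integrable M F" "\<And>x. x \<notin> K \<Longrightarrow> F x = 0" for F :: "'a \<Rightarrow> real" and \<theta>
  proof -
    have "\<psi> F \<theta> + \<psi> F (\<theta> + pi) =
        (\<integral>x. indicator {x. 0 \<le> w \<theta> x} x * F x + indicator {x. 0 \<le> w (\<theta> + pi) x} x * F x \<partial>M)"
      unfolding \<psi>_def by (rule Bochner_Integration.integral_add[symmetric]) (intro integ F)+
    also have "\<dots> = integral\<^sup>L M F"
    proof (rule integral_cong_AE)
      show "AE x in M. indicator {x. 0 \<le> w \<theta> x} x * F x + indicator {x. 0 \<le> w (\<theta> + pi) x} x * F x = F x"
        using ae[of \<theta>]
      proof eventually_elim
        fix x assume "x \<in> K \<longrightarrow> w \<theta> x \<noteq> 0"
        moreover have "w (\<theta> + pi) x = - w \<theta> x" by (simp add: w_def)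
        ultimately show "indicator {x. 0 \<le> w \<theta> x} x * F x + indicator {x. 0 \<le> w (\<theta> + pi) x} x * F x = F x"
          using F(2)[of x] by (cases "x \<in> K") (auto split: split_indicator)
      qed
    qed (use integ[OF F(1)] F(1) in auto)
    finally show ?thesis .
  qed
  have cont: "continuous_on S (\<psi> f)" for S
    unfolding continuous_on_sequentially comp_def
  proof (intro allI ballI impI, elim conjE)
    fix \<Theta> :: "nat \<Rightarrow> real" and \<theta> assume lim: "\<Theta> \<longlonglongrightarrow> \<theta>"
    show "(\<lambda>n. \<psi> f (\<Theta> n)) \<longlonglongrightarrow> \<psi> f \<theta>"
      unfolding \<psi>_def
    proof (rule integral_dominated_convergence[where w = "\<lambda>x. norm (f x)"])
      show "AE x in M. (\<lambda>n. indicator {x. 0 \<le> w (\<Theta> n) x} x * f x) \<longlonglongrightarrow> indicator {x. 0 \<le> w \<theta> x} x * f x"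
        using ae[of \<theta>]
      proof eventually_elim
        fix x assume x: "x \<in> K \<longrightarrow> w \<theta> x \<noteq> 0"
        show "(\<lambda>n. indicator {x. 0 \<le> w (\<Theta> n) x} x * f x) \<longlonglongrightarrow> indicator {x. 0 \<le> w \<theta> x} x * f x"
        proof (cases "x \<in> K")
          case True
          have wlim: "(\<lambda>n. w (\<Theta> n) x) \<longlonglongrightarrow> w \<theta> x"
            unfolding w_def using lim by (intro tendsto_intros)
          have "\<forall>\<^sub>F n in sequentially. (0 \<le> w (\<Theta> n) x) = (0 \<le> w \<theta> x)"
          proof (cases "0 < w \<theta> x")
            case True
            then show ?thesis using order_tendstoD(1)[OF wlim True] by (auto elim!: eventually_mono)
          next
            case False
            then have "w \<theta> x < 0" using x \<open>x \<in> K\<close> by auto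
            then show ?thesis using order_tendstoD(2)[OF wlim, of 0] by (auto elim!: eventually_mono)
          qed
          then have "\<forall>\<^sub>F n in sequentially. indicator {x. 0 \<le> w (\<Theta> n) x} x * f x = indicator {x. 0 \<le> w \<theta> x} x * f x"
            by eventually_elim (simp add: indicator_def)
          then show ?thesis by (rule tendsto_eventually)
        qed (simp add: f(3))
      qed
    qed (use integ[OF f(1)] f(1) in \<open>auto split: split_indicator\<close>)
  qed
  define D where "D \<theta> = \<psi> f \<theta> - \<psi> f (\<theta> + pi)" for \<theta>
  have contD: "continuous_on {0..pi} D"
    unfolding D_def by (intro continuous_intros cont continuous_on_compose2[OF cont[of UNIV]]) auto
  have "D pi = - D 0"
    by (simp add: D_def \<psi>_def w_def)
  then have "\<exists>\<theta>\<ge>0. \<theta> \<le> pi \<and> D \<theta> = 0"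
    using IVT'[of D 0 0 pi, OF _ _ _ contD] IVT2'[of D pi 0 0, OF _ _ _ contD]
    by (cases "D 0 \<le> 0") auto
  then obtain \<theta> where "D \<theta> = 0" by blast
  then have half: "0 < \<psi> f \<theta>" "0 < \<psi> f (\<theta> + pi)"
    using antipodal[OF f(1,3), of \<theta>] f(2) by (auto simp: D_def)
  have "0 < \<psi> g \<theta> \<or> 0 < \<psi> g (\<theta> + pi)"
    using antipodal[OF g(1,3), of \<theta>] g(2) by linarith
  then obtain \<theta>' where "0 < \<psi> f \<theta>'" "0 < \<psi> g \<theta>'" using half by blast
  then show ?thesis
    using cs[of \<theta>'] unfolding \<psi>_def w_def by blast
qed

section \<open>Continuous minorants depending on finitely many functionals\<close>

definition continuous_functionals :: "('a::locally_convex_space \<Rightarrow> real) set" where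
  "continuous_functionals = {l. linear l \<and> continuous_on UNIV l}"

text \<open>
  Continuous functions on \<open>K\<close> that factor through finitely many continuous linear functionals. The
  factorisation is expressed without naming a map to a finite-dimensional space, so no
  dimension occurs in a type.
\<close>

definition cylinder_functions :: "'a::locally_convex_space set \<Rightarrow> ('a \<Rightarrow> real) set" where
  "cylinder_functions K = {f. continuous_on K f \<and>
     (\<exists>\<Lambda>. finite \<Lambda> \<and> \<Lambda> \<subseteq> continuous_functionals \<and>
        (\<forall>x\<in>K. \<forall>y\<in>K. (\<forall>l\<in>\<Lambda>. l x = l y) \<longrightarrow> f x = f y))}"

lemma cylinder_functions_combine:
  assumes "f \<in> cylinder_functions K" "g \<in> cylinder_functions K"
    and "continuous_on K (\<lambda>x. F (f x) (g x))"
  shows "(\<lambda>x. F (f x) (g x)) \<in> cylinder_functions K"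
proof -
  obtain \<Lambda> where \<Lambda>: "finite \<Lambda>" "\<Lambda> \<subseteq> continuous_functionals"
    "\<forall>x\<in>K. \<forall>y\<in>K. (\<forall>l\<in>\<Lambda>. l x = l y) \<longrightarrow> f x = f y"
    using assms(1) unfolding cylinder_functions_def by blast
  obtain \<Lambda>' where \<Lambda>': "finite \<Lambda>'" "\<Lambda>' \<subseteq> continuous_functionals"
    "\<forall>x\<in>K. \<forall>y\<in>K. (\<forall>l\<in>\<Lambda>'. l x = l y) \<longrightarrow> g x = g y"
    using assms(2) unfolding cylinder_functions_def by blast
  have "\<forall>x\<in>K. \<forall>y\<in>K. (\<forall>l\<in>\<Lambda> \<union> \<Lambda>'. l x = l y) \<longrightarrow> F (f x) (g x) = F (f y) (g y)"
    using \<Lambda>(3) \<Lambda>'(3) by (metis Un_iff)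
  moreover have "finite (\<Lambda> \<union> \<Lambda>')" "\<Lambda> \<union> \<Lambda>' \<subseteq> continuous_functionals"
    using \<Lambda>(1,2) \<Lambda>'(1,2) by simp_all
  ultimately show ?thesis
    unfolding cylinder_functions_def
    by (intro CollectI conjI[OF assms(3)] exI[of _ "\<Lambda> \<union> \<Lambda>'"] conjI)
qed

lemma function_ring_on_cylinder_functions:
  assumes "compact K"
  shows "function_ring_on (cylinder_functions K) K"
proof
  show "compact K" by fact
  show cont: "continuous_on K f" if "f \<in> cylinder_functions K" for f
    using that by (simp add: cylinder_functions_def)
  show "(\<lambda>x. f x + g x) \<in> cylinder_functions K"
    if "f \<in> cylinder_functions K" "g \<in> cylinder_functions K" for f g
    by (rule cylinder_functions_combine[where F = "(+)", OF that continuous_on_add[OF that[THEN cont]]])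
  show "(\<lambda>x. f x * g x) \<in> cylinder_functions K"
    if "f \<in> cylinder_functions K" "g \<in> cylinder_functions K" for f g
    by (rule cylinder_functions_combine[where F = "(*)", OF that continuous_on_mult[OF that[THEN cont]]])
  show "(\<lambda>_. c) \<in> cylinder_functions K" for c
    unfolding cylinder_functions_def by (auto intro!: exI[of _ "{}"])
  fix x y assume "x \<in> K" "y \<in> K" "x \<noteq> y"
  then obtain l :: "'a \<Rightarrow> real" where l: "linear l" "continuous_on UNIV l" "l x \<noteq> l y"
    using continuous_linear_functionals_separate_points by blast
  then have "l \<in> cylinder_functions K"
    unfolding cylinder_functions_def continuous_functionals_def
    by (auto intro!: exI[of _ "{l}"] intro: continuous_on_subset)
  then show "\<exists>f\<in>cylinder_functions K. f x \<noteq> f y" using l(3) by blast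
qed

lemma integrable_continuous_on_compact:
  fixes M :: "'a::t2_space measure" and f :: "'a \<Rightarrow> real"
  assumes "finite_measure M" "sets M = sets borel" "compact K" "continuous_on K f"
  shows "integrable M (\<lambda>x. indicator K x * f x)"
proof -
  interpret finite_measure M by fact
  obtain b where b: "0 < b" "\<And>x. x \<in> K \<Longrightarrow> \<bar>f x\<bar> \<le> b"
    using compact_imp_bounded[OF compact_continuous_image[OF assms(4,3)]] unfolding bounded_pos
    by (metis image_eqI real_norm_def)
  have "(\<lambda>x. indicator K x *\<^sub>R f x) \<in> borel_measurable borel"
    by (rule borel_measurable_continuous_on_indicator[OF borel_compact[OF assms(3)] assms(4)])
  then have "(\<lambda>x. indicator K x * f x) \<in> borel_measurable M"
    by (simp add: measurable_cong_sets[OF assms(2) refl])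
  then show ?thesis
    using b by (intro integrable_const_bound[of _ b]) (auto split: split_indicator)
qed

text \<open>
  A cylinder function close to 1 on a compact subset of \<open>U \<inter> K\<close> of almost full measure and close to 0 on
  \<open>K - U\<close> exists by the separation lemma for function rings; lowering it by the error puts it below the
  indicator of \<open>U\<close>.
\<close>

lemma cylinder_function_below_open:
  fixes M :: "'a::locally_convex_space measure"
  assumes M: "finite_measure M" "radon_measure M" and K: "compact K" and U: "open U" and \<eta>: "0 < \<eta>"
  obtains \<phi> where "\<phi> \<in> cylinder_functions K" "\<And>x. x \<in> K \<Longrightarrow> \<phi> x \<le> indicator U x"
    "measure M (U \<inter> K) - \<eta> \<le> (\<integral>x. indicator K x * \<phi> x \<partial>M)"
proof -
  interpret finite_measure M by fact
  interpret ring: function_ring_on "cylinder_functions K" K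
    by (rule function_ring_on_cylinder_functions[OF K])
  have sets: "sets M = sets borel" using M(2) by (simp add: radon_measure_def)
  have KM: "K \<in> sets M" by (simp add: sets borel_compact K)
  have "U \<inter> K \<in> sets borel" using U K by (intro sets.Int borel_open borel_compact)
  moreover have "measure M (U \<inter> K) - \<eta> / 2 < measure M (U \<inter> K)" using \<eta> by simp
  ultimately obtain C where C: "compact C" "C \<in> sets borel" "C \<subseteq> U \<inter> K" "measure M (U \<inter> K) - \<eta> / 2 < measure M C"
    by (rule radon_measure_inner_compact[OF M])
  define e where "e = min (1/2) (\<eta> / 4 / (measure M K + 1))"
  have mK: "0 < measure M K + 1" using measure_nonneg[of M K] by linarith
  have e: "0 < e" "e < 1" using \<eta> mK by (auto simp: e_def)
  have "e * (measure M K + 1) \<le> \<eta> / 4 / (measure M K + 1) * (measure M K + 1)"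
    using mK by (intro mult_right_mono) (auto simp: e_def)
  also have "\<dots> = \<eta> / 4"
  proof -
    have "\<eta> / 4 / d * d = \<eta> / 4" if "0 < d" for d using that by simp
    from this[OF mK] show ?thesis .
  qed
  finally have eK: "e * measure M K \<le> \<eta> / 4" using e by (simp add: distrib_left)
  have clD: "closed (K - U)" using K U by (simp add: closed_Diff compact_imp_closed)
  obtain f where f: "f \<in> cylinder_functions K" "f ` K \<subseteq> {0..1}" "\<forall>x\<in>K - U. f x < e" "\<forall>x\<in>C. 1 - e < f x"
    using ring.two[OF clD _ compact_imp_closed[OF C(1)] _ _ e] C(3) by blast
  define \<phi> where "\<phi> x = f x - e" for x
  have \<phi>R: "\<phi> \<in> cylinder_functions K"
    unfolding \<phi>_def by (rule ring.diff[OF f(1) ring.const])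
  show thesis
  proof (rule that[OF \<phi>R])
    show "\<phi> x \<le> indicator U x" if "x \<in> K" for x
    proof (cases "x \<in> U")
      case True
      have "f x \<le> 1" using f(2) that by auto
      then show ?thesis using True e by (simp add: \<phi>_def)
    next
      case False
      then show ?thesis using f(3) that by (auto simp: \<phi>_def intro: less_imp_le)
    qed
    have CM: "C \<in> sets M" by (simp add: sets borel_compact C)
    have "measure M (U \<inter> K) - \<eta> \<le> measure M C - 2 * (e * measure M K)"
      using C(4) eK by linarith
    also have "\<dots> \<le> (1 - e) * measure M C - e * measure M K"
    proof -
      have "e * measure M C \<le> e * measure M K"
        using C(3) KM e by (intro mult_left_mono finite_measure_mono) auto
      then show ?thesis by (simp add: algebra_simps)
    qed
    also have "\<dots> = (\<integral>x. (1 - e) * indicator C x - e * indicator K x \<partial>M)"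
      using CM KM by (subst Bochner_Integration.integral_diff)
        (auto intro!: integrable_mult_right integrable_real_indicator simp: less_top[symmetric])
    also have "\<dots> \<le> (\<integral>x. indicator K x * \<phi> x \<partial>M)"
    proof (rule integral_mono)
      show "integrable M (\<lambda>x. (1 - e) * indicator C x - e * indicator K x)"
        using CM KM by (intro Bochner_Integration.integrable_diff integrable_mult_right integrable_real_indicator)
          (auto simp: less_top[symmetric])
      show "integrable M (\<lambda>x. indicator K x * \<phi> x)"
        by (rule integrable_continuous_on_compact[OF M(1) sets K ring.continuous[OF \<phi>R]])
      show "(1 - e) * indicator C x - e * indicator K x \<le> indicator K x * \<phi> x" for x
        using f(2,4) C(3) e by (cases "x \<in> C"; cases "x \<in> K") (auto simp: \<phi>_def less_imp_le)
    qed
    finally show "measure M (U \<inter> K) - \<eta> \<le> (\<integral>x. indicator K x * \<phi> x \<partial>M)" .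
  qed
qed

text \<open>
  The layer-cake approximation from below with steps of height \<open>h\<close>.
\<close>

lemma layer_sum_bounds:
  fixes w h :: real
  assumes "0 < h" "0 \<le> w"
  shows "(\<Sum>k=1..N. h * of_bool (real k * h < w)) \<le> w"
    "w \<le> real N * h \<Longrightarrow> w - h \<le> (\<Sum>k=1..N. h * of_bool (real k * h < w))"
proof -
  define s where "s N = (\<Sum>k=1..N. h * of_bool (real k * h < w))" for N
  have s0: "s 0 = 0" by (simp add: s_def)
  have step: "s (Suc N) = s N + h * of_bool (real (Suc N) * h < w)" for N by (simp add: s_def)
  have "s N \<le> w \<and> (w \<le> real N * h \<longrightarrow> w - h \<le> s N) \<and> (real N * h < w \<longrightarrow> s N = real N * h)"
  proof (induction N)
    case 0
    then show ?case using assms s0 by auto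
  next
    case (Suc N)
    show ?case
    proof (cases "real (Suc N) * h < w")
      case True
      then have "real N * h < w" using assms(1) by (simp add: algebra_simps)
      then show ?thesis using Suc True step[of N] by (simp add: algebra_simps)
    next
      case False
      then show ?thesis
        using Suc step[of N] by (cases "real N * h < w") (auto simp: algebra_simps)
    qed
  qed
  then show "(\<Sum>k=1..N. h * of_bool (real k * h < w)) \<le> w"
    "w \<le> real N * h \<Longrightarrow> w - h \<le> (\<Sum>k=1..N. h * of_bool (real k * h < w))"
    unfolding s_def by blast+
qed

lemma lower_semicontinuous_bounded_below_on_compact:
  assumes u: "lower_semicontinuous u" and K: "compact K"
  obtains m where "0 \<le> m" "\<And>x. x \<in> K \<Longrightarrow> - m \<le> u x"
proof -
  have "K \<subseteq> (\<Union>n::nat. {x. - real n < u x})"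
  proof
    fix x
    obtain n where "- u x < real n" using reals_Archimedean2 by blast
    then show "x \<in> (\<Union>n::nat. {x. - real n < u x})" by (auto intro!: exI[of _ n])
  qed
  moreover have "open {x. - real n < u x}" for n :: nat
    using u by (simp add: lower_semicontinuous_def)
  ultimately obtain F where F: "finite F" "K \<subseteq> (\<Union>n\<in>F. {x. - real n < u x})"
    using compactE_image[OF K, of UNIV "\<lambda>n::nat. {x. - real n < u x}"] by metis
  show thesis
  proof (rule that[of "real (\<Sum>F)"])
    fix x assume "x \<in> K"
    then obtain n where n: "n \<in> F" "- real n < u x" using F by auto
    then have "n \<le> \<Sum>F" using F(1) member_le_sum[of n F "\<lambda>x. x"] by auto
    then show "- real (\<Sum>F) \<le> u x" using n(2) by linarith
  qed (simp add: sum_nonneg)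
qed

lemma lower_semicontinuous_borel_measurable:
  assumes "lower_semicontinuous u"
  shows "u \<in> borel_measurable borel"
  using assms unfolding lower_semicontinuous_def
  by (intro borel_measurableI_greater) (simp add: greaterThan_def)

text \<open>
  After truncation from above, \<open>u + m\<close> is bounded between 0 and a constant and is approximated from below
  by a sum of \<open>N\<close> indicators of the open superlevel sets, each of which is replaced by a cylinder function
  below it.
\<close>

theorem cylinder_minorant:
  fixes M :: "'a::locally_convex_space measure"
  assumes M: "finite_measure M" "radon_measure M" and K: "compact K"
    and u: "lower_semicontinuous u" "integrable M (\<lambda>x. indicator K x * u x)"
      "0 < (\<integral>x. indicator K x * u x \<partial>M)"
  obtains f where "f \<in> cylinder_functions K" "\<And>x. x \<in> K \<Longrightarrow> f x \<le> u x"
    "0 < (\<integral>x. indicator K x * f x \<partial>M)"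
proof -
  interpret finite_measure M by fact
  interpret ring: function_ring_on "cylinder_functions K" K
    by (rule function_ring_on_cylinder_functions[OF K])
  have sets: "sets M = sets borel" using M(2) by (simp add: radon_measure_def)
  have KM [measurable]: "K \<in> sets M" by (simp add: sets borel_compact K)
  have um [measurable]: "u \<in> borel_measurable M"
    unfolding measurable_cong_sets[OF sets refl] by (rule lower_semicontinuous_borel_measurable[OF u(1)])
  obtain m where m: "0 \<le> m" "\<And>x. x \<in> K \<Longrightarrow> - m \<le> u x"
    using lower_semicontinuous_bounded_below_on_compact[OF u(1) K] by blast
  have "(\<lambda>n. \<integral>x. indicator K x * min (u x) (real n) \<partial>M) \<longlonglongrightarrow> (\<integral>x. indicator K x * u x \<partial>M)"
  proof (rule integral_dominated_convergence[where w = "\<lambda>x. norm (indicator K x * u x)"])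
    show "AE x in M. (\<lambda>n. indicator K x * min (u x) (real n)) \<longlonglongrightarrow> indicator K x * u x"
    proof (rule AE_I2)
      fix x
      obtain n0 where n0: "u x < real n0" using reals_Archimedean2 by blast
      have "\<forall>\<^sub>F n in sequentially. indicator K x * min (u x) (real n) = indicator K x * u x"
        using eventually_ge_at_top[of n0] by eventually_elim (use n0 in auto)
      then show "(\<lambda>n. indicator K x * min (u x) (real n)) \<longlonglongrightarrow> indicator K x * u x"
        by (rule tendsto_eventually)
    qed
  qed (use u(2) in \<open>auto split: split_indicator\<close>)
  then have "\<forall>\<^sub>F n in sequentially. 0 < (\<integral>x. indicator K x * min (u x) (real n) \<partial>M)"
    using u(3) by (intro order_tendstoD)
  then obtain c where c: "0 < (\<integral>x. indicator K x * min (u x) (real c) \<partial>M)"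
    by (auto simp: eventually_sequentially)
  define I where "I = (\<integral>x. indicator K x * min (u x) (real c) \<partial>M)"
  \<comment> \<open>\<open>B\<close> bounds \<open>min u c + m\<close>; the summand 1 keeps it positive.\<close>
  define B where "B = real c + m + 1"
  have B: "0 < B" using m by (simp add: B_def)
  have I: "0 < I" using c by (simp add: I_def)
  obtain N :: nat where N: "4 * B * (measure M K + 1) / I < real N" using reals_Archimedean2 by blast
  define h where "h = B / real N"
  have "0 < 4 * B * (measure M K + 1) / I"
    using B I measure_nonneg[of M K] by (intro divide_pos_pos mult_pos_pos) linarith+
  then have N0: "0 < N" using N by linarith
  have h: "0 < h" "real N * h = B" using B N0 by (auto simp: h_def)
  have hK: "h * measure M K < I / 4"
  proof -
    have "4 * B * measure M K \<le> 4 * B * (measure M K + 1)" using B by simp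
    also have "\<dots> < real N * I" using N I by (simp add: field_simps)
    finally show ?thesis using N0 by (simp add: h_def field_simps)
  qed
  define \<eta> where "\<eta> = I / (4 * B)"
  have \<eta>: "0 < \<eta>" using I B by (simp add: \<eta>_def)
  define U where "U k = {x. real k * h - m < u x}" for k :: nat
  have U: "open (U k)" for k using u(1) by (simp add: U_def lower_semicontinuous_def)
  have "\<exists>\<phi>. \<phi> \<in> cylinder_functions K \<and> (\<forall>x\<in>K. \<phi> x \<le> indicator (U k) x) \<and>
      measure M (U k \<inter> K) - \<eta> \<le> (\<integral>x. indicator K x * \<phi> x \<partial>M)" for k
    using cylinder_function_below_open[OF M K U \<eta>] by metis
  then obtain \<phi> where \<phi>: "\<And>k. \<phi> k \<in> cylinder_functions K" "\<And>k x. x \<in> K \<Longrightarrow> \<phi> k x \<le> indicator (U k) x"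
    "\<And>k. measure M (U k \<inter> K) - \<eta> \<le> (\<integral>x. indicator K x * \<phi> k x \<partial>M)"
    by metis
  define f where "f x = (\<Sum>k=1..N. h * \<phi> k x) - m" for x
  define s where "s x = (\<Sum>k=1..N. h * of_bool (real k * h < u x + m))" for x
  have s_indicator: "s x = (\<Sum>k=1..N. h * indicator (U k) x)" for x
    by (simp add: s_def U_def indicator_def algebra_simps)
  have \<phi>int: "integrable M (\<lambda>x. indicator K x * \<phi> k x)" for k
    by (rule integrable_continuous_on_compact[OF M(1) sets K ring.continuous[OF \<phi>(1)]])
  have UM: "U k \<inter> K \<in> sets M" for k using U KM by (simp add: sets)
  have Kint: "integrable M (\<lambda>x. indicator K x * a)" for a :: real
    using KM by (auto intro!: integrable_mult_left integrable_real_indicator simp: less_top[symmetric])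
  have K_s: "indicator K x * s x = (\<Sum>k=1..N. h * indicator (U k \<inter> K) x)" for x
    unfolding s_indicator sum_distrib_left by (rule sum.cong) (auto split: split_indicator)
  have s_lower: "min (u x) (real c) + m - h \<le> s x" if "x \<in> K" for x
  proof -
    let ?w = "min (u x) (real c) + m"
    have "?w - h \<le> (\<Sum>k=1..N. h * of_bool (real k * h < ?w))"
      using m(2)[OF that] m(1) h B_def by (intro layer_sum_bounds) auto
    also have "\<dots> \<le> s x"
      unfolding s_def using h by (intro sum_mono mult_left_mono) auto
    finally show ?thesis .
  qed
  have sint: "integrable M (\<lambda>x. indicator K x * s x)"
  proof -
    have "integrable M (\<lambda>x. \<Sum>k=1..N. h * indicator (U k \<inter> K) x)"
      using UM by (intro Bochner_Integration.integrable_sum integrable_mult_right integrable_real_indicator)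
        (auto simp: less_top[symmetric])
    then show ?thesis by (simp only: K_s)
  qed
  show thesis
  proof (rule that)
    show "f \<in> cylinder_functions K"
      unfolding f_def by (intro ring.diff ring.sum ring.mult ring.const \<phi>) auto
    show "f x \<le> u x" if x: "x \<in> K" for x
    proof -
      have "(\<Sum>k=1..N. h * \<phi> k x) \<le> s x"
        unfolding s_indicator using h \<phi>(2)[OF x] by (intro sum_mono mult_left_mono) auto
      also have "\<dots> \<le> u x + m"
        unfolding s_def using h m(2)[OF x] by (intro layer_sum_bounds) auto
      finally show ?thesis by (simp add: f_def)
    qed
    have "I + m * measure M K - h * measure M K
        = (\<integral>x. indicator K x * min (u x) (real c) + indicator K x * m - indicator K x * h \<partial>M)"
    proof -
      have "integrable M (\<lambda>x. indicator K x * min (u x) (real c))"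
        by (rule Bochner_Integration.integrable_bound[OF Bochner_Integration.integrable_add[OF integrable_norm[OF u(2)] Kint[of "real c"]]])
          (auto split: split_indicator simp: min_def abs_if)
      then show ?thesis using Kint by (simp add: I_def mult.commute)
    qed
    also have "\<dots> \<le> (\<integral>x. indicator K x * s x \<partial>M)"
    proof (rule integral_mono[OF _ sint])
      show "integrable M (\<lambda>x. indicator K x * min (u x) (real c) + indicator K x * m - indicator K x * h)"
        by (intro Bochner_Integration.integrable_diff Bochner_Integration.integrable_add Kint
              Bochner_Integration.integrable_bound[OF Bochner_Integration.integrable_add[OF integrable_norm[OF u(2)] Kint[of "real c"]]])
          (auto split: split_indicator simp: min_def abs_if)
      show "indicator K x * min (u x) (real c) + indicator K x * m - indicator K x * h \<le> indicator K x * s x" for x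
        using s_lower[of x] by (auto split: split_indicator)
    qed
    also have "\<dots> = (\<Sum>k=1..N. h * measure M (U k \<inter> K))"
    proof -
      have "(\<integral>x. indicator K x * s x \<partial>M) = (\<integral>x. (\<Sum>k=1..N. h * indicator (U k \<inter> K) x) \<partial>M)"
        by (simp only: K_s)
      also have "\<dots> = (\<Sum>k=1..N. h * measure M (U k \<inter> K))"
        using UM by (subst Bochner_Integration.integral_sum)
          (auto intro!: integrable_mult_right integrable_real_indicator simp: less_top[symmetric])
      finally show ?thesis .
    qed
    also have "\<dots> \<le> (\<Sum>k=1..N. h * ((\<integral>x. indicator K x * \<phi> k x \<partial>M) + \<eta>))"
      using h \<phi>(3) by (intro sum_mono mult_left_mono) (auto simp: algebra_simps)
    also have "\<dots> = (\<Sum>k=1..N. h * (\<integral>x. indicator K x * \<phi> k x \<partial>M)) + B * \<eta>"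
      using h(2) by (simp add: sum.distrib algebra_simps)
    also have "(\<Sum>k=1..N. h * (\<integral>x. indicator K x * \<phi> k x \<partial>M)) = (\<integral>x. (\<Sum>k=1..N. h * (indicator K x * \<phi> k x)) \<partial>M)"
      using \<phi>int by (subst Bochner_Integration.integral_sum) auto
    also have "\<dots> = (\<integral>x. indicator K x * f x + indicator K x * m \<partial>M)"
      by (rule Bochner_Integration.integral_cong) (auto simp: f_def split: split_indicator)
    also have "\<dots> = (\<integral>x. indicator K x * f x \<partial>M) + m * measure M K"
    proof -
      have "integrable M (\<lambda>x. indicator K x * f x)"
        by (rule integrable_continuous_on_compact[OF M(1) sets K ring.continuous[OF \<open>f \<in> cylinder_functions K\<close>]])
      then show ?thesis using Kint by (simp add: mult.commute)
    qed
    finally have "I - h * measure M K - B * \<eta> \<le> (\<integral>x. indicator K x * f x \<partial>M)" by simp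
    moreover have "B * \<eta> = I / 4" using B by (simp add: \<eta>_def)
    ultimately show "0 < (\<integral>x. indicator K x * f x \<partial>M)" using hK I by linarith
  qed
qed

section \<open>Iterated bisection\<close>

lemma linear_functional_affine:
  fixes l :: "'a::real_vector \<Rightarrow> real"
  assumes "linear l"
  shows "l ((1 - t) *\<^sub>R x + t *\<^sub>R y) = (1 - t) * l x + t * l y"
  by (simp add: linear_add[OF assms] linear_scale[OF assms])

text \<open>
  By the zero-one law for hyperplanes every boundary line is either null or of full measure in \<open>K\<close>, as the
  rotation argument requires.
\<close>

lemma bisection_step:
  fixes M :: "'a::locally_convex_space measure" and f g :: "'a \<Rightarrow> real"
  assumes M: "finite_measure M" "sets M = sets borel" "compact_concave \<alpha> M"
    and K: "compact K" "convex K"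
    and f: "continuous_on K f" "0 < (\<integral>x. indicator K x * f x \<partial>M)"
    and g: "continuous_on K g" "0 < (\<integral>x. indicator K x * g x \<partial>M)"
    and l: "l1 \<in> continuous_functionals" "l2 \<in> continuous_functionals"
  obtains c d where "(c, d) \<noteq> (0, 0)"
    "compact (K \<inter> {x. 0 \<le> c * (l1 x - p) + d * (l2 x - q)})"
    "convex (K \<inter> {x. 0 \<le> c * (l1 x - p) + d * (l2 x - q)})"
    "0 < (\<integral>x. indicator (K \<inter> {x. 0 \<le> c * (l1 x - p) + d * (l2 x - q)}) x * f x \<partial>M)"
    "0 < (\<integral>x. indicator (K \<inter> {x. 0 \<le> c * (l1 x - p) + d * (l2 x - q)}) x * g x \<partial>M)"
proof -
  interpret finite_measure M by fact
  define h where "h c d x = c * (l1 x - p) + d * (l2 x - q)" for c d x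
  have cont: "continuous_on UNIV (h c d)" for c d
    unfolding h_def using l by (intro continuous_intros) (auto simp: continuous_functionals_def)
  have aff: "h c d ((1 - t) *\<^sub>R x + t *\<^sub>R y) = (1 - t) * h c d x + t * h c d y" for c d x y t
  proof -
    have "linear l1" "linear l2" using l by (auto simp: continuous_functionals_def)
    then show ?thesis unfolding h_def
      by (simp only: linear_functional_affine) (simp add: algebra_simps)
  qed
  have hm: "h c d \<in> borel_measurable M" for c d
    unfolding measurable_cong_sets[OF M(2) refl] by (rule borel_measurable_continuous_onI[OF cont])
  have zero_one: "(AE x in M. x \<in> K \<longrightarrow> h c d x = 0) \<or> (AE x in M. x \<in> K \<longrightarrow> h c d x \<noteq> 0)" for c d
  proof (cases "0 < measure M (K \<inter> {x. h c d x = 0})")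
    case True
    then show ?thesis
      using compact_concave_hyperplane_zero_one[OF M K cont aff] by blast
  next
    case False
    have "closed {x. h c d x = 0}"
      by (intro closed_Collect_eq cont continuous_on_const)
    then have "K \<inter> {x. h c d x = 0} \<in> sets M"
      unfolding M(2) using K(1) by (intro sets.Int borel_compact borel_closed)
    then have "K \<inter> {x. h c d x = 0} \<in> null_sets M"
      using False by (simp add: null_sets_def emeasure_eq_measure zero_less_measure_iff)
    then have "AE x in M. x \<notin> K \<inter> {x. h c d x = 0}" by (rule AE_not_in)
    then show ?thesis by (intro disjI2) (auto elim: eventually_mono)
  qed
  have "h 1 0 = (\<lambda>x. l1 x - p)" "h 0 1 = (\<lambda>x. l2 x - q)" by (auto simp: h_def)
  then have lm: "(\<lambda>x. l1 x - p) \<in> borel_measurable M" "(\<lambda>x. l2 x - q) \<in> borel_measurable M"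
    using hm[of 1 0] hm[of 0 1] by simp_all
  have "\<exists>c d. (c, d) \<noteq> (0, 0) \<and>
     0 < (\<integral>x. indicator {x. 0 \<le> c * (l1 x - p) + d * (l2 x - q)} x * (indicator K x * f x) \<partial>M) \<and>
     0 < (\<integral>x. indicator {x. 0 \<le> c * (l1 x - p) + d * (l2 x - q)} x * (indicator K x * g x) \<partial>M)"
  proof (rule halfplane_bisection[where K = K])
    show "integrable M (\<lambda>x. indicator K x * f x)" "integrable M (\<lambda>x. indicator K x * g x)"
      by (intro integrable_continuous_on_compact[OF M(1,2) K(1)] f g)+
    fix c d :: real
    show "(AE x in M. x \<in> K \<longrightarrow> c * (l1 x - p) + d * (l2 x - q) = 0) \<or>
      (AE x in M. x \<in> K \<longrightarrow> c * (l1 x - p) + d * (l2 x - q) \<noteq> 0)"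
      using zero_one[of c d] by (simp add: h_def)
  qed (use f g lm in auto)
  then obtain c d where cd: "(c, d) \<noteq> (0, 0)"
     "0 < (\<integral>x. indicator {x. 0 \<le> h c d x} x * (indicator K x * f x) \<partial>M)"
     "0 < (\<integral>x. indicator {x. 0 \<le> h c d x} x * (indicator K x * g x) \<partial>M)"
    unfolding h_def by blast
  have clo: "closed {x. 0 \<le> h c d x}" by (intro closed_Collect_le cont continuous_on_const)
  have conv: "convex {x. 0 \<le> h c d x}"
    unfolding convex_alt by (auto simp: aff)
  have ind: "indicator {x. 0 \<le> h c d x} x * (indicator K x * F x) = indicator (K \<inter> {x. 0 \<le> h c d x}) x * F x"
    for F :: "'a \<Rightarrow> real" and x by (auto split: split_indicator)
  show thesis
    using that[OF cd(1), folded h_def] cd(2,3) clo conv K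
    by (simp add: ind compact_Int_closed convex_Int)
qed

text \<open>
  The cuts are indexed by two functionals and a rational point of the plane, so there are
  countably many of them and each is made once. The zero functional is added to the index set so that
  it can be enumerated even if \<open>\<Lambda>\<close> is empty.
\<close>

lemma bisection_sequence:
  fixes M :: "'a::locally_convex_space measure" and f g :: "'a \<Rightarrow> real"
  assumes M: "finite_measure M" "sets M = sets borel" "compact_concave \<alpha> M"
    and K: "compact K" "convex K"
    and f: "continuous_on K f" "0 < (\<integral>x. indicator K x * f x \<partial>M)"
    and g: "continuous_on K g" "0 < (\<integral>x. indicator K x * g x \<partial>M)"
    and \<Lambda>: "finite \<Lambda>" "\<Lambda> \<subseteq> continuous_functionals"
  obtains C :: "nat \<Rightarrow> 'a set" where "decseq C"
    "\<And>n. compact (C n)" "\<And>n. convex (C n)" "\<And>n. C n \<subseteq> K"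
    "\<And>n. 0 < (\<integral>x. indicator (C n) x * f x \<partial>M)" "\<And>n. 0 < (\<integral>x. indicator (C n) x * g x \<partial>M)"
    "\<And>l1 l2 p q. l1 \<in> \<Lambda> \<Longrightarrow> l2 \<in> \<Lambda> \<Longrightarrow> \<exists>n c d. (c, d) \<noteq> (0, 0) \<and>
       (\<forall>x\<in>C n. 0 \<le> c * (l1 x - real_of_rat p) + d * (l2 x - real_of_rat q))"
proof -
  define I where "I = (insert (\<lambda>_. 0) \<Lambda> \<times> insert (\<lambda>_. 0) \<Lambda>) \<times> (UNIV :: (rat \<times> rat) set)"
  have "countable (insert (\<lambda>_. 0) \<Lambda>)" using \<Lambda>(1) by (simp add: countable_finite)
  then have I: "I \<noteq> {}" "countable I"
    unfolding I_def by (blast, intro countable_SIGMA) auto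
  have zero: "(\<lambda>_. 0) \<in> continuous_functionals"
    by (auto simp: continuous_functionals_def linear_iff)
  define P where "P A \<longleftrightarrow> compact A \<and> convex A \<and> A \<subseteq> K \<and>
      0 < (\<integral>x. indicator A x * f x \<partial>M) \<and> 0 < (\<integral>x. indicator A x * g x \<partial>M)" for A
  define Q where "Q n A B \<longleftrightarrow> B \<subseteq> A \<and> (case from_nat_into I n of ((l1, l2), (p, q)) \<Rightarrow>
      \<exists>c d. (c, d) \<noteq> (0, 0) \<and> (\<forall>x\<in>B. 0 \<le> c * (l1 x - real_of_rat p) + d * (l2 x - real_of_rat q)))"
    for n and A B :: "'a set"
  have "\<exists>C. \<forall>n. P (C n) \<and> Q n (C n) (C (Suc n))"
  proof (rule dependent_nat_choice)
    show "\<exists>A. P A" using K f g by (auto simp: P_def)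
  next
    fix A n assume A: "P A"
    obtain l1 l2 p q where lpq: "from_nat_into I n = ((l1, l2), (p, q))" by (metis surj_pair)
    then have "((l1, l2), (p, q)) \<in> I" using from_nat_into[OF I(1), of n] by simp
    then have l: "l1 \<in> continuous_functionals" "l2 \<in> continuous_functionals"
      using \<Lambda>(2) zero by (auto simp: I_def)
    have A': "compact A" "convex A" "A \<subseteq> K" "continuous_on A f" "continuous_on A g"
      "0 < (\<integral>x. indicator A x * f x \<partial>M)" "0 < (\<integral>x. indicator A x * g x \<partial>M)"
      using A f(1) g(1) by (auto simp: P_def intro: continuous_on_subset)
    define H where "H c d = {x. 0 \<le> c * (l1 x - real_of_rat p) + d * (l2 x - real_of_rat q)}" for c d
    obtain c d where cd: "(c, d) \<noteq> (0, 0)" "compact (A \<inter> H c d)" "convex (A \<inter> H c d)"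
      "0 < (\<integral>x. indicator (A \<inter> H c d) x * f x \<partial>M)" "0 < (\<integral>x. indicator (A \<inter> H c d) x * g x \<partial>M)"
      unfolding H_def by (rule bisection_step[OF M A'(1,2,4,6,5,7) l])
    have "P (A \<inter> H c d)" using cd A'(3) by (auto simp: P_def)
    moreover have "Q n A (A \<inter> H c d)" using cd(1) by (auto simp: Q_def lpq H_def)
    ultimately show "\<exists>B. P B \<and> Q n A B" by blast
  qed
  then obtain C where C: "\<And>n. P (C n)" "\<And>n. Q n (C n) (C (Suc n))" by blast
  show thesis
  proof (rule that[of C])
    show "decseq C" using C(2) by (auto simp: decseq_Suc_iff Q_def)
    fix l1 l2 p q assume "l1 \<in> \<Lambda>" "l2 \<in> \<Lambda>"
    then have "((l1, l2), (p, q)) \<in> range (from_nat_into I)"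
      unfolding range_from_nat_into[OF I] by (auto simp: I_def)
    then obtain n where "from_nat_into I n = ((l1, l2), (p, q))" by (metis rangeE)
    then show "\<exists>n c d. (c, d) \<noteq> (0, 0) \<and> (\<forall>x\<in>C n. 0 \<le> c * (l1 x - real_of_rat p) + d * (l2 x - real_of_rat q))"
      using C(2)[of n] by (intro exI[of _ "Suc n"]) (simp add: Q_def)
  qed (use C(1) in \<open>auto simp: P_def\<close>)
qed

text \<open>
  The weights of a rational point sufficiently near the centroid are near 1/3.
\<close>

lemma triangle_contains_rational_point:
  fixes a b U1 U2 V1 V2 :: real
  assumes D: "U1 * V2 - U2 * V1 \<noteq> 0"
  obtains p q :: rat and s t where "0 < s" "0 < t" "s + t < 1"
    "real_of_rat p = a + s * U1 + t * V1" "real_of_rat q = b + s * U2 + t * V2"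
proof -
  define D where "D = U1 * V2 - U2 * V1"
  define S where "S = \<bar>U1\<bar> + \<bar>U2\<bar> + \<bar>V1\<bar> + \<bar>V2\<bar> + 1"
  have D0: "D \<noteq> 0" using D by (simp add: D_def)
  have S: "0 < S" by (simp add: S_def)
  \<comment> \<open>With this \<open>e\<close>, moving by less than \<open>e\<close> in both coordinates changes each weight by less than 1/6.\<close>
  define e where "e = \<bar>D\<bar> / (6 * S)"
  have e: "0 < e" "e * S = \<bar>D\<bar> / 6" using D0 S by (auto simp: e_def)
  obtain p where p: "a + (U1 + V1) / 3 < real_of_rat p" "real_of_rat p < a + (U1 + V1) / 3 + e"
    using of_rat_dense[of "a + (U1 + V1) / 3" "a + (U1 + V1) / 3 + e"] e by auto
  obtain q where q: "b + (U2 + V2) / 3 < real_of_rat q" "real_of_rat q < b + (U2 + V2) / 3 + e"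
    using of_rat_dense[of "b + (U2 + V2) / 3" "b + (U2 + V2) / 3 + e"] e by auto
  define x where "x = real_of_rat p - a - (U1 + V1) / 3"
  define y where "y = real_of_rat q - b - (U2 + V2) / 3"
  have xy: "\<bar>x\<bar> < e" "\<bar>y\<bar> < e" using p q by (auto simp: x_def y_def)
  have small: "\<bar>x * v - y * w\<bar> < \<bar>D\<bar> / 6" if "\<bar>v\<bar> + \<bar>w\<bar> < S" for v w
  proof -
    have "\<bar>x * v - y * w\<bar> \<le> \<bar>x\<bar> * \<bar>v\<bar> + \<bar>y\<bar> * \<bar>w\<bar>"
      using abs_triangle_ineq4[of "x * v" "y * w"] by (simp add: abs_mult)
    also have "\<dots> \<le> e * \<bar>v\<bar> + e * \<bar>w\<bar>"
      using xy by (intro add_mono mult_right_mono) auto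
    also have "\<dots> < e * S" using that e(1) by (simp add: distrib_left[symmetric])
    finally show ?thesis using e(2) by simp
  qed
  define s' where "s' = (x * V2 - y * V1) / D"
  define t' where "t' = (y * U1 - x * U2) / D"
  define s where "s = 1 / 3 + s'"
  define t where "t = 1 / 3 + t'"
  have "\<bar>s'\<bar> < 1 / 6"
    using small[of V2 V1] D0 by (simp add: s'_def S_def field_simps)
  then have s: "1 / 6 < s" "s < 1 / 2" unfolding s_def by linarith+
  have "\<bar>t'\<bar> < 1 / 6"
    using small[of U2 U1] D0 by (simp add: t'_def S_def field_simps abs_minus_commute)
  then have t: "1 / 6 < t" "t < 1 / 2" unfolding t_def by linarith+
  have "x = (s - 1/3) * U1 + (t - 1/3) * V1"
  proof -
    have "(s - 1/3) * U1 + (t - 1/3) * V1 = ((x * V2 - y * V1) * U1 + (y * U1 - x * U2) * V1) / D"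
      by (simp add: s_def t_def s'_def t'_def add_divide_distrib)
    also have "(x * V2 - y * V1) * U1 + (y * U1 - x * U2) * V1 = x * D" by (simp add: D_def algebra_simps)
    finally show ?thesis using D0 by simp
  qed
  moreover have "y = (s - 1/3) * U2 + (t - 1/3) * V2"
  proof -
    have "(s - 1/3) * U2 + (t - 1/3) * V2 = ((x * V2 - y * V1) * U2 + (y * U1 - x * U2) * V2) / D"
      by (simp add: s_def t_def s'_def t'_def add_divide_distrib)
    also have "(x * V2 - y * V1) * U2 + (y * U1 - x * U2) * V2 = y * D" by (simp add: D_def algebra_simps)
    finally show ?thesis using D0 by simp
  qed
  ultimately have "real_of_rat p = a + s * U1 + t * V1" "real_of_rat q = b + s * U2 + t * V2"
    by (auto simp: x_def y_def algebra_simps add_divide_distrib)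
  then show thesis using s t by (intro that[of s t p q]) auto
qed

text \<open>
  If the images under \<open>(l0, l)\<close> of three points of \<open>S\<close> were not collinear, the triangle would contain a
  rational point with positive weights. A half-plane bounded by a line through this point contains the
  three corners, so the line itself would contain all three of them.
\<close>

lemma functionals_collapse:
  fixes S :: "'a::real_vector set"
  assumes cut: "\<And>l1 l2 p q. l1 \<in> \<Lambda> \<Longrightarrow> l2 \<in> \<Lambda> \<Longrightarrow> \<exists>c d. (c, d) \<noteq> (0, 0) \<and>
       (\<forall>x\<in>S. 0 \<le> c * (l1 x - real_of_rat p) + d * (l2 x - real_of_rat q))"
  obtains l0 where "l0 \<in> insert (\<lambda>_. 0) \<Lambda>" "\<And>l. l \<in> \<Lambda> \<Longrightarrow> \<exists>a b. \<forall>x\<in>S. l x = a * l0 x + b"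
proof (cases "\<exists>l0\<in>\<Lambda>. \<exists>x\<in>S. \<exists>y\<in>S. l0 x \<noteq> l0 y")
  case False
  note const = this
  show thesis
  proof (rule that[of "\<lambda>_. 0"])
    fix l assume l: "l \<in> \<Lambda>"
    show "\<exists>a b. \<forall>x\<in>S. l x = a * 0 + b"
    proof (cases "S = {}")
      case False
      then obtain z where "z \<in> S" by blast
      then have "\<forall>x\<in>S. l x = 0 * 0 + l z" using const l by auto
      then show ?thesis by (intro exI[of _ 0] exI[of _ "l z"])
    qed simp
  qed simp
next
  case True
  then obtain l0 where l0': "l0 \<in> \<Lambda>" "\<exists>x\<in>S. \<exists>y\<in>S. l0 x \<noteq> l0 y" by (rule bexE)
  from l0'(2) obtain x0 where x0: "x0 \<in> S" "\<exists>y\<in>S. l0 x0 \<noteq> l0 y" by (rule bexE)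
  from x0(2) obtain x1 where x1: "x1 \<in> S" "l0 x0 \<noteq> l0 x1" by (rule bexE)
  note l0 = l0'(1) x0(1) x1
  show thesis
  proof (rule that[of l0])
    fix l assume l: "l \<in> \<Lambda>"
    have "l y = (l x1 - l x0) / (l0 x1 - l0 x0) * l0 y + (l x0 - (l x1 - l x0) / (l0 x1 - l0 x0) * l0 x0)"
      if y: "y \<in> S" for y
    proof -
      define U1 U2 V1 V2 where "U1 = l0 x1 - l0 x0" and "U2 = l x1 - l x0" and "V1 = l0 y - l0 x0" and "V2 = l y - l x0"
      note UV = this
      have "U1 * V2 - U2 * V1 = 0"
      proof (rule ccontr)
        assume D: "U1 * V2 - U2 * V1 \<noteq> 0"
        obtain p q s t where st: "0 < s" "0 < t" "s + t < 1"
          and pq: "real_of_rat p = l0 x0 + s * U1 + t * V1" "real_of_rat q = l x0 + s * U2 + t * V2"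
          by (rule triangle_contains_rational_point[OF D, of "l0 x0" "l x0"])
        obtain c d where cd: "(c, d) \<noteq> (0, 0)"
          "\<forall>x\<in>S. 0 \<le> c * (l0 x - real_of_rat p) + d * (l x - real_of_rat q)"
          using cut[OF l0(1) l, of p q] by (elim exE conjE)
        define A where "A x = c * (l0 x - real_of_rat p) + d * (l x - real_of_rat q)" for x
        have nonneg: "0 \<le> A x0" "0 \<le> A x1" "0 \<le> A y" using cd(2) l0 y by (auto simp: A_def)
        have sum: "(1 - s - t) * A x0 + s * A x1 + t * A y = 0"
          unfolding A_def pq UV by (simp add: algebra_simps)
        have "0 \<le> (1 - s - t) * A x0" "0 \<le> s * A x1" "0 \<le> t * A y"
          using st nonneg by auto
        with sum have "(1 - s - t) * A x0 = 0" "s * A x1 = 0" "t * A y = 0" by linarith+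
        then have zero: "A x0 = 0" "A x1 = 0" "A y = 0" using st by auto
        have "c * U1 + d * U2 = A x1 - A x0" "c * V1 + d * V2 = A y - A x0"
          by (auto simp: A_def UV algebra_simps)
        then have *: "c * U1 + d * U2 = 0" "c * V1 + d * V2 = 0" using zero by auto
        have "c * (U1 * V2 - U2 * V1) = (c * U1 + d * U2) * V2 - (c * V1 + d * V2) * U2"
          "d * (U1 * V2 - U2 * V1) = (c * V1 + d * V2) * U1 - (c * U1 + d * U2) * V1"
          by (auto simp: algebra_simps)
        then have "c * (U1 * V2 - U2 * V1) = 0" "d * (U1 * V2 - U2 * V1) = 0" using * by auto
        then show False using D cd(1) by auto
      qed
      then have "V2 = U2 / U1 * V1" using l0(4) by (simp add: UV field_simps)
      moreover define r where "r = (l x1 - l x0) / (l0 x1 - l0 x0)"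
      ultimately have "l y - l x0 = r * (l0 y - l0 x0)" by (simp only: UV)
      then show ?thesis unfolding r_def[symmetric] by (simp add: algebra_simps)
    qed
    then show "\<exists>a b. \<forall>x\<in>S. l x = a * l0 x + b" by blast
  qed (use l0 in simp)
qed

lemma decreasing_compacts_eventually_below:
  fixes C :: "nat \<Rightarrow> 'a::t2_space set" and \<phi> :: "'a \<Rightarrow> real"
  assumes C: "decseq C" "\<And>n. compact (C n)" and \<phi>: "continuous_on (C 0) \<phi>"
    and less: "\<And>x. x \<in> (\<Inter>n. C n) \<Longrightarrow> \<phi> x < \<delta>"
  shows "\<forall>\<^sub>F n in sequentially. \<forall>x\<in>C n. \<phi> x < \<delta>"
proof -
  define Z where "Z = {x \<in> C 0. \<delta> \<le> \<phi> x}"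
  have "closed Z"
    unfolding Z_def using C(2)[of 0] \<phi>
    by (intro continuous_on_closed_Collect_le continuous_on_const) (auto intro: compact_imp_closed)
  then have Z: "compact Z"
  proof -
    have "Z = C 0 \<inter> Z" by (auto simp: Z_def)
    then show ?thesis using compact_Int_closed[OF C(2)[of 0] \<open>closed Z\<close>] by simp
  qed
  have sub: "Z \<subseteq> (\<Union>n. - C n)" using less by (force simp: Z_def)
  obtain F where F: "finite F" "Z \<subseteq> (\<Union>n\<in>F. - C n)"
    by (rule compactE_image[OF Z open_Compl[OF compact_imp_closed[OF C(2)]] sub]) blast
  have "\<forall>x\<in>C n. \<phi> x < \<delta>" if n: "\<forall>k\<in>F. k \<le> n" for n
  proof (rule ballI, rule ccontr)
    fix x assume x: "x \<in> C n" "\<not> \<phi> x < \<delta>"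
    then have "x \<in> Z" using decseqD[OF C(1), of 0 n] by (auto simp: Z_def)
    then obtain k where "k \<in> F" "x \<notin> C k" using F by auto
    then show False using decseqD[OF C(1), of k n] n x by auto
  qed
  moreover have "\<forall>\<^sub>F n in sequentially. \<forall>k\<in>F. k \<le> n"
    using F(1) by (simp add: eventually_ball_finite eventually_ge_at_top)
  ultimately show ?thesis by (auto elim: eventually_mono)
qed

text \<open>
  The closed convex hulls of compact sets of almost full measure are still compact.
\<close>

lemma exhaustion_by_compact_convex:
  fixes M :: "'a::locally_convex_space measure"
  assumes complete: "complete (UNIV :: 'a set)" and M: "finite_measure M" "radon_measure M"
  obtains K :: "nat \<Rightarrow> 'a set" where "\<And>n. compact (K n)" "\<And>n. convex (K n)" "incseq K"
    "AE x in M. x \<in> (\<Union>n. K n)"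
proof -
  interpret finite_measure M by fact
  have sets: "sets M = sets borel" using M(2) by (simp add: radon_measure_def)
  have space: "space M = UNIV" using sets_eq_imp_space_eq[OF sets] by simp
  have "\<exists>C. compact C \<and> measure M UNIV - inverse (real (Suc n)) < measure M C" for n
    using radon_measure_inner_compact[OF M, of UNIV "measure M UNIV - inverse (real (Suc n))"] by force
  then obtain C where C: "\<And>n. compact (C n)" "\<And>n. measure M UNIV - inverse (real (Suc n)) < measure M (C n)"
    by metis
  define K where "K n = closure (convex hull (\<Union>i\<le>n. C i))" for n
  have K: "compact (K n)" "convex (K n)" for n
    unfolding K_def using C(1)
    by (auto intro!: compact_closed_convex_hull[OF complete] compact_UN convex_closure_lcs)
  have CK: "C n \<subseteq> K n" for n
  proof -
    have "C n \<subseteq> (\<Union>i\<le>n. C i)" by auto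
    also have "\<dots> \<subseteq> convex hull (\<Union>i\<le>n. C i)" by (rule hull_subset)
    also have "\<dots> \<subseteq> K n" unfolding K_def by (rule closure_subset)
    finally show ?thesis .
  qed
  have inc: "incseq K"
    unfolding K_def by (intro incseq_SucI closure_mono hull_mono UN_mono) auto
  have KM: "K n \<in> sets M" for n using K by (simp add: sets borel_compact)
  have "measure M UNIV \<le> measure M (\<Union>n. K n)"
  proof (rule field_le_epsilon)
    fix e :: real assume "0 < e"
    then obtain n where n: "inverse (real (Suc n)) < e" using reals_Archimedean by blast
    have "measure M (C n) \<le> measure M (\<Union>n. K n)"
      using CK KM by (intro finite_measure_mono) auto
    then show "measure M UNIV \<le> measure M (\<Union>n. K n) + e" using C(2)[of n] n by linarith
  qed
  then have "measure M (UNIV - (\<Union>n. K n)) = 0"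
    using KM finite_measure_compl[of "\<Union>n. K n"] measure_nonneg[of M "UNIV - (\<Union>n. K n)"]
    by (auto simp: space intro!: antisym)
  moreover have "UNIV - (\<Union>n. K n) \<in> sets M"
    using KM sets.compl_sets[of "\<Union>n. K n" M] by (auto simp: space)
  ultimately have "UNIV - (\<Union>n. K n) \<in> null_sets M" by (simp add: null_sets_def emeasure_eq_measure)
  then have "AE x in M. x \<notin> UNIV - (\<Union>n. K n)" by (rule AE_not_in)
  then have "AE x in M. x \<in> (\<Union>n. K n)" by simp
  from that[OF K inc this] show thesis .
qed

lemma integral_incseq_tendsto:
  fixes u :: "'a \<Rightarrow> real"
  assumes "incseq K" "\<And>n. K n \<in> sets M" "AE x in M. x \<in> (\<Union>n. K n)" "integrable M u"
  shows "(\<lambda>n. \<integral>x. indicator (K n) x * u x \<partial>M) \<longlonglongrightarrow> integral\<^sup>L M u"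
proof (rule integral_dominated_convergence[where w = "\<lambda>x. norm (u x)"])
  show "AE x in M. (\<lambda>n. indicator (K n) x * u x) \<longlonglongrightarrow> u x"
    using assms(3)
  proof eventually_elim
    fix x assume "x \<in> (\<Union>n. K n)"
    then obtain n0 where n0: "x \<in> K n0" by blast
    have "\<forall>\<^sub>F n in sequentially. indicator (K n) x * u x = u x"
      using eventually_ge_at_top[of n0]
    proof eventually_elim
      fix n assume "n0 \<le> n"
      then have "x \<in> K n" using incseqD[OF assms(1)] n0 by blast
      then show "indicator (K n) x * u x = u x" by simp
    qed
    then show "(\<lambda>n. indicator (K n) x * u x) \<longlonglongrightarrow> u x" by (rule tendsto_eventually)
  qed
next
  show "(\<lambda>x. indicator (K n) x * u x) \<in> borel_measurable M" for n
    using borel_measurable_integrable[OF assms(4)] assms(2)[of n]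
    by (intro borel_measurable_times borel_measurable_indicator)
  show "AE x in M. norm (indicator (K n) x * u x) \<le> norm (u x)" for n
    by (rule AE_I2) (simp split: split_indicator)
qed (use assms(4) in \<open>simp_all add: borel_measurable_integrable\<close>)

section \<open>Transporting the limit measure to a segment\<close>

lemma integral_uniform_measure:
  fixes h :: "'a \<Rightarrow> real"
  assumes "finite_measure M" "K \<in> sets M" "0 < measure M K" "h \<in> borel_measurable M"
  shows "(\<integral>x. h x \<partial>uniform_measure M K) = (\<integral>x. indicator K x * h x \<partial>M) / measure M K"
proof -
  interpret finite_measure M by fact
  have "indicator K x / emeasure M K = ennreal (indicator K x / measure M K)" for x
    using assms(3) divide_ennreal[of 1 "measure M K"]
    by (cases "x \<in> K") (simp_all add: emeasure_eq_measure)
  then have "uniform_measure M K = density M (\<lambda>x. ennreal (indicator K x / measure M K))"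
    by (simp add: uniform_measure_def)
  then have "(\<integral>x. h x \<partial>uniform_measure M K) = (\<integral>x. (indicator K x / measure M K) *\<^sub>R h x \<partial>M)"
    using assms by (simp only:) (intro integral_density, auto)
  also have "\<dots> = (\<integral>x. (indicator K x * h x) / measure M K \<partial>M)" by simp
  finally show ?thesis by (simp only: integral_divide_zero)
qed

text \<open>
  Inner regularity on the real line is automatic, and continuous images of compact sets are compact.
\<close>

lemma radon_measure_distr_real:
  fixes \<sigma> :: "real \<Rightarrow> 'b::t2_space"
  assumes "finite_measure P" "sets P = sets borel" and \<sigma>: "continuous_on UNIV \<sigma>"
  shows "radon_measure (distr P borel \<sigma>)"
proof -
  interpret finite_measure P by fact
  have space: "space P = UNIV" using sets_eq_imp_space_eq[OF assms(2)] by simp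
  have \<sigma>m: "\<sigma> \<in> measurable P borel"
    unfolding measurable_cong_sets[OF assms(2) refl] by (rule borel_measurable_continuous_onI[OF \<sigma>])
  have dist: "emeasure (distr P borel \<sigma>) A = emeasure P (\<sigma> -` A)" if "A \<in> sets borel" for A
    using that \<sigma>m by (simp add: emeasure_distr space)
  interpret \<nu>: finite_measure "distr P borel \<sigma>" by (rule finite_measure_distr[OF \<sigma>m])
  show ?thesis
    unfolding radon_measure_def
  proof (intro conjI allI ballI)
    fix x show "\<exists>U. open U \<and> x \<in> U \<and> emeasure (distr P borel \<sigma>) U < \<infinity>"
      by (intro exI[of _ UNIV]) (simp add: \<nu>.emeasure_finite less_top[symmetric])
  next
    fix A :: "'b set" assume A: "A \<in> sets borel"
    let ?\<K> = "{K. compact K \<and> K \<in> sets borel \<and> K \<subseteq> A}"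
    show "emeasure (distr P borel \<sigma>) A = (SUP K\<in>?\<K>. emeasure (distr P borel \<sigma>) K)"
    proof (rule antisym)
      have "\<sigma> -` A \<in> sets borel" using measurable_sets[OF \<sigma>m A] by (simp add: space assms(2))
      then have "emeasure P (\<sigma> -` A) = (SUP K\<in>{K. K \<subseteq> \<sigma> -` A \<and> compact K}. emeasure P K)"
        using emeasure_finite by (intro inner_regular assms(2)) auto
      also have "\<dots> \<le> (SUP K\<in>?\<K>. emeasure (distr P borel \<sigma>) K)"
      proof (rule SUP_least)
        fix C assume C: "C \<in> {K. K \<subseteq> \<sigma> -` A \<and> compact K}"
        then have cC: "compact (\<sigma> ` C)"
          using \<sigma> by (auto intro: compact_continuous_image continuous_on_subset)
        then have bC: "\<sigma> ` C \<in> sets borel" by (rule borel_compact)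
        have "emeasure P C \<le> emeasure P (\<sigma> -` \<sigma> ` C)"
          using measurable_sets[OF \<sigma>m bC] by (intro emeasure_mono) (auto simp: space)
        also have "\<dots> = emeasure (distr P borel \<sigma>) (\<sigma> ` C)" by (rule dist[OF bC, symmetric])
        also have "\<dots> \<le> (SUP K\<in>?\<K>. emeasure (distr P borel \<sigma>) K)"
          using C cC bC by (intro SUP_upper) auto
        finally show "emeasure P C \<le> (SUP K\<in>?\<K>. emeasure (distr P borel \<sigma>) K)" .
      qed
      finally show "emeasure (distr P borel \<sigma>) A \<le> (SUP K\<in>?\<K>. emeasure (distr P borel \<sigma>) K)"
        by (simp add: dist[OF A])
      show "(SUP K\<in>?\<K>. emeasure (distr P borel \<sigma>) K) \<le> emeasure (distr P borel \<sigma>) A"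
        using A by (intro SUP_least emeasure_mono) auto
    qed
  qed simp
qed

text \<open>
  The function \<open>u\<close> itself need not be integrable for the transported measure; an integrable minorant
  \<open>G\<close> bounds its negative part and keeps its positive part large.
\<close>

lemma extended_set_integral_distr_pos:
  fixes \<sigma> :: "real \<Rightarrow> 'b::t2_space" and u :: "'b \<Rightarrow> real" and G :: "real \<Rightarrow> real"
  assumes P: "sets P = sets borel" and \<sigma>: "continuous_on UNIV \<sigma>"
    and u: "u \<in> borel_measurable borel" and S: "S \<in> sets borel"
    and ae: "AE r in P. \<sigma> r \<in> S \<and> G r \<le> u (\<sigma> r)"
    and G: "integrable P G" "0 < integral\<^sup>L P G"
  shows "0 < extended_set_integral (distr P borel \<sigma>) S u"
proof -
  have \<sigma>m: "\<sigma> \<in> measurable P borel"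
    unfolding measurable_cong_sets[OF P refl] by (rule borel_measurable_continuous_onI[OF \<sigma>])
  have tr: "(\<integral>\<^sup>+x\<in>S. ennreal (h x) \<partial>distr P borel \<sigma>) = (\<integral>\<^sup>+r. ennreal (h (\<sigma> r)) * indicator S (\<sigma> r) \<partial>P)"
    if "h \<in> borel_measurable borel" for h :: "'b \<Rightarrow> real"
    using that S \<sigma>m by (intro nn_integral_distr) auto
  define a where "a = (\<integral>\<^sup>+r. ennreal (G r) \<partial>P)"
  define b where "b = (\<integral>\<^sup>+r. ennreal (- G r) \<partial>P)"
  have fin: "a \<noteq> \<infinity>" "b \<noteq> \<infinity>"
    using G(1) unfolding real_integrable_def a_def b_def by auto
  have "integral\<^sup>L P G = enn2real a - enn2real b"
    unfolding a_def b_def by (rule real_lebesgue_integral_def[OF G(1)])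
  then have ab: "b < a"
    using G(2) fin enn2real_mono[of a b] by (force simp: not_le[symmetric] less_top)
  have "a \<le> (\<integral>\<^sup>+x\<in>S. ennreal (u x) \<partial>distr P borel \<sigma>)"
    unfolding tr[OF u] a_def
    by (rule nn_integral_mono_AE, rule AE_mp[OF ae]) (auto intro!: AE_I2 ennreal_leI)
  moreover have "(\<integral>\<^sup>+x\<in>S. ennreal (- u x) \<partial>distr P borel \<sigma>) \<le> b"
    unfolding tr[OF borel_measurable_uminus[OF u]] b_def
    by (rule nn_integral_mono_AE, rule AE_mp[OF ae]) (auto intro!: AE_I2 ennreal_leI)
  ultimately have "(\<integral>\<^sup>+x\<in>S. ennreal (- u x) \<partial>distr P borel \<sigma>) < (\<integral>\<^sup>+x\<in>S. ennreal (u x) \<partial>distr P borel \<sigma>)"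
    using ab by order
  then show ?thesis
    unfolding extended_set_integral_def by (intro ereal_diff_gr0) (simp add: less_ennreal.rep_eq[symmetric])
qed

text \<open>
  Room for strict inequalities to become weak ones in a limit.
\<close>

lemma positive_integral_minus_const:
  fixes M :: "'a::t2_space measure" and f :: "'a \<Rightarrow> real"
  assumes "finite_measure M" "sets M = sets borel" "compact K" "continuous_on K f"
    and pos: "0 < (\<integral>x. indicator K x * f x \<partial>M)"
  obtains e where "0 < e" "0 < (\<integral>x. indicator K x * (f x - e) \<partial>M)"
proof -
  interpret finite_measure M by fact
  define I where "I = (\<integral>x. indicator K x * f x \<partial>M)"
  define e where "e = I / (2 * (measure M K + 1))"
  have mK: "0 < measure M K + 1" using measure_nonneg[of M K] by linarith
  have e: "0 < e" using pos mK by (simp add: e_def I_def)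
  have "I / (2 * d) * d = I / 2" if "0 < d" for d using that by simp
  from this[OF mK] have "e * (measure M K + 1) = I / 2" by (simp only: e_def)
  then have eK: "e * measure M K < I" using e pos by (simp add: I_def distrib_left)
  have int: "integrable M (\<lambda>x. indicator K x * f x)" "integrable M (\<lambda>x. indicator K x * e)"
    by (intro integrable_continuous_on_compact[OF assms(1-3)] assms(4) continuous_on_const)+
  have "(\<integral>x. indicator K x * (f x - e) \<partial>M) = I - (\<integral>x. indicator K x * e \<partial>M)"
    using int by (simp add: I_def right_diff_distrib)
  also have "(\<integral>x. indicator K x * e \<partial>M) = e * measure M K"
    using assms(2,3) by (simp add: borel_compact)
  finally show thesis using that[OF e] eK by simp
qed

theorem theorem1p2:
  fixes \<mu> :: "'a::locally_convex_space measure"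
    and \<alpha> :: ereal
    and u v :: "'a \<Rightarrow> real"
  assumes "complete (UNIV :: 'a set)"
    and "finite_measure \<mu>"
    and "alpha_concave \<alpha> \<mu>"
    and "lower_semicontinuous u" and "lower_semicontinuous v"
    and "integrable \<mu> u" and "integrable \<mu> v"
    and "(\<integral>x. u x \<partial>\<mu>) > 0" and "(\<integral>x. v x \<partial>\<mu>) > 0"
  shows "\<exists>(a::'a) (b::'a) (\<nu>::'a measure).
           finite_measure \<nu> \<and> alpha_concave \<alpha> \<nu> \<and>
           supported_on \<nu> (closed_segment a b) \<and>
           extended_set_integral \<nu> (closed_segment a b) u > 0 \<and>
           extended_set_integral \<nu> (closed_segment a b) v > 0"
proof -
  interpret finite_measure \<mu> by fact
  have radon: "radon_measure \<mu>" using assms(3) by (simp add: alpha_concave_def)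
  have sets: "sets \<mu> = sets borel" using radon by (simp add: radon_measure_def)
  have space: "space \<mu> = UNIV" using sets_eq_imp_space_eq[OF sets] by simp
  have conc: "compact_concave \<alpha> \<mu>"
    by (rule alpha_concave_imp_compact_concave[OF assms(2,3)])
  obtain K' where K': "\<And>n. compact (K' n)" "\<And>n. convex (K' n)" "incseq K'" "AE x in \<mu>. x \<in> (\<Union>n. K' n)"
    by (rule exhaustion_by_compact_convex[OF assms(1,2) radon]) blast
  have K'm: "K' n \<in> sets \<mu>" for n using K'(1) by (simp add: sets borel_compact)
  have "\<forall>\<^sub>F n in sequentially. 0 < (\<integral>x. indicator (K' n) x * u x \<partial>\<mu>)"
    by (rule order_tendstoD(1)[OF integral_incseq_tendsto[OF K'(3) K'm K'(4) assms(6)] assms(8)])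
  moreover have "\<forall>\<^sub>F n in sequentially. 0 < (\<integral>x. indicator (K' n) x * v x \<partial>\<mu>)"
    by (rule order_tendstoD(1)[OF integral_incseq_tendsto[OF K'(3) K'm K'(4) assms(7)] assms(9)])
  ultimately have "\<forall>\<^sub>F n in sequentially. 0 < (\<integral>x. indicator (K' n) x * u x \<partial>\<mu>) \<and> 0 < (\<integral>x. indicator (K' n) x * v x \<partial>\<mu>)"
    by (rule eventually_conj)
  then obtain n0 where n0: "0 < (\<integral>x. indicator (K' n0) x * u x \<partial>\<mu>)" "0 < (\<integral>x. indicator (K' n0) x * v x \<partial>\<mu>)"
    by (auto simp: eventually_sequentially)
  define K where "K = K' n0"
  have K: "compact K" "convex K" using K' by (auto simp: K_def)
  have KM: "K \<in> sets \<mu>" using K'm by (simp add: K_def)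
  have int: "integrable \<mu> (\<lambda>x. indicator K x * u x)" "integrable \<mu> (\<lambda>x. indicator K x * v x)"
    using integrable_mult_indicator[OF KM assms(6)] integrable_mult_indicator[OF KM assms(7)] by simp_all
  obtain f where f: "f \<in> cylinder_functions K" "\<And>x. x \<in> K \<Longrightarrow> f x \<le> u x" "0 < (\<integral>x. indicator K x * f x \<partial>\<mu>)"
    by (rule cylinder_minorant[OF assms(2) radon K(1) assms(4) int(1) n0(1)[folded K_def]]) blast
  obtain g where g: "g \<in> cylinder_functions K" "\<And>x. x \<in> K \<Longrightarrow> g x \<le> v x" "0 < (\<integral>x. indicator K x * g x \<partial>\<mu>)"
    by (rule cylinder_minorant[OF assms(2) radon K(1) assms(5) int(2) n0(2)[folded K_def]]) blast
  have fcont: "continuous_on K f" and gcont: "continuous_on K g"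
    using f(1) g(1) by (auto simp: cylinder_functions_def)
  obtain \<Lambda>f where \<Lambda>f: "finite \<Lambda>f" "\<Lambda>f \<subseteq> continuous_functionals"
    "\<forall>x\<in>K. \<forall>y\<in>K. (\<forall>l\<in>\<Lambda>f. l x = l y) \<longrightarrow> f x = f y"
    using f(1) unfolding cylinder_functions_def mem_Collect_eq by (elim exE conjE)
  obtain \<Lambda>g where \<Lambda>g: "finite \<Lambda>g" "\<Lambda>g \<subseteq> continuous_functionals"
    "\<forall>x\<in>K. \<forall>y\<in>K. (\<forall>l\<in>\<Lambda>g. l x = l y) \<longrightarrow> g x = g y"
    using g(1) unfolding cylinder_functions_def mem_Collect_eq by (elim exE conjE)
  define \<Lambda> where "\<Lambda> = \<Lambda>f \<union> \<Lambda>g"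
  have \<Lambda>: "finite \<Lambda>" "\<Lambda> \<subseteq> continuous_functionals" using \<Lambda>f \<Lambda>g by (auto simp: \<Lambda>_def)
  \<comment> \<open>Positivity of the integral of \<open>f - e1\<close> survives in the limit as a positive lower bound for the mean of \<open>f\<close>.\<close>
  obtain e1 where e1: "0 < e1" "0 < (\<integral>x. indicator K x * (f x - e1) \<partial>\<mu>)"
    by (rule positive_integral_minus_const[OF assms(2) sets K(1) fcont f(3)])
  obtain e2 where e2: "0 < e2" "0 < (\<integral>x. indicator K x * (g x - e2) \<partial>\<mu>)"
    by (rule positive_integral_minus_const[OF assms(2) sets K(1) gcont g(3)])
  obtain C where C: "decseq C" "\<And>n. compact (C n)" "\<And>n. convex (C n)" "\<And>n. C n \<subseteq> K"
    "\<And>n. 0 < (\<integral>x. indicator (C n) x * (f x - e1) \<partial>\<mu>)" "\<And>n. 0 < (\<integral>x. indicator (C n) x * (g x - e2) \<partial>\<mu>)"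
    and cut: "\<And>l1 l2 p q. l1 \<in> \<Lambda> \<Longrightarrow> l2 \<in> \<Lambda> \<Longrightarrow> \<exists>n c d. (c, d) \<noteq> (0, 0) \<and>
       (\<forall>x\<in>C n. 0 \<le> c * (l1 x - real_of_rat p) + d * (l2 x - real_of_rat q))"
    by (rule bisection_sequence[OF assms(2) sets conc K
          continuous_on_diff[OF fcont continuous_on_const] e1(2)
          continuous_on_diff[OF gcont continuous_on_const] e2(2) \<Lambda>]) blast
  have CM: "C n \<in> sets \<mu>" for n using C(2) by (simp add: sets borel_compact)
  have Cpos: "0 < measure \<mu> (C n)" for n
  proof (rule ccontr)
    assume "\<not> 0 < measure \<mu> (C n)"
    then have "C n \<in> null_sets \<mu>"
      using CM by (simp add: null_sets_def emeasure_eq_measure zero_less_measure_iff)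
    then have "AE x in \<mu>. x \<notin> C n" by (rule AE_not_in)
    then have "AE x in \<mu>. indicator (C n) x * (f x - e1) = 0" by (auto elim: eventually_mono)
    then have "(\<integral>x. indicator (C n) x * (f x - e1) \<partial>\<mu>) = 0" by (rule integral_eq_zero_AE)
    then show False using C(5)[of n] by simp
  qed
  define S where "S = (\<Inter>n. C n)"
  have S: "compact S" "convex S" "S \<subseteq> K"
  proof -
    have "S = C 0 \<inter> (\<Inter>n. C n)" by (auto simp: S_def)
    moreover have "closed (\<Inter>n. C n)" using C(2) by (intro closed_INT ballI compact_imp_closed)
    ultimately show "compact S" using compact_Int_closed[OF C(2)[of 0]] by simp
    show "convex S" unfolding S_def by (intro convex_INT C)
    show "S \<subseteq> K" using C(4) by (auto simp: S_def)
  qed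
  \<comment> \<open>A strict continuous inequality on \<open>S\<close> eventually holds on \<open>C n\<close>; this controls both supports and integrals.\<close>
  have shrink: "\<forall>\<^sub>F n in sequentially. \<forall>x\<in>C n. \<phi> x < \<delta>"
    if "continuous_on K \<phi>" "\<And>x. x \<in> S \<Longrightarrow> \<phi> x < \<delta>" for \<phi> :: "'a \<Rightarrow> real" and \<delta>
    using that C(4)[of 0] unfolding S_def
    by (intro decreasing_compacts_eventually_below[OF C(1,2)]) (auto intro: continuous_on_subset)
  \<comment> \<open>If \<open>S\<close> were empty, \<open>1 < 1\<close> would hold on \<open>S\<close> and hence on some \<open>C n\<close>, which has positive measure.\<close>
  have Sne: "S \<noteq> {}"
  proof
    assume "S = {}"
    then have "\<forall>\<^sub>F n in sequentially. \<forall>x\<in>C n. (1::real) < 1"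
      by (intro shrink continuous_on_const) auto
    then obtain n where "C n = {}" by (auto simp: eventually_sequentially)
    then show False using Cpos[of n] by simp
  qed
  obtain l0 where l0: "l0 \<in> insert (\<lambda>_. 0) \<Lambda>" "\<And>l. l \<in> \<Lambda> \<Longrightarrow> \<exists>a b. \<forall>x\<in>S. l x = a * l0 x + b"
  proof (rule functionals_collapse[where \<Lambda> = \<Lambda> and S = S])
    fix l1 l2 p q assume "l1 \<in> \<Lambda>" "l2 \<in> \<Lambda>"
    from cut[OF this, of p q] obtain n c d where ncd: "(c, d) \<noteq> (0, 0)"
      "\<forall>x\<in>C n. 0 \<le> c * (l1 x - real_of_rat p) + d * (l2 x - real_of_rat q)" by (elim exE conjE)
    then have "\<forall>x\<in>S. 0 \<le> c * (l1 x - real_of_rat p) + d * (l2 x - real_of_rat q)"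
      by (auto simp: S_def)
    with ncd(1) show "\<exists>c d. (c, d) \<noteq> (0, 0) \<and>
       (\<forall>x\<in>S. 0 \<le> c * (l1 x - real_of_rat p) + d * (l2 x - real_of_rat q))" by (intro exI conjI)
  qed blast
  have lin: "linear l0" and lcont: "continuous_on UNIV l0"
    using l0(1) \<Lambda>(2) by (auto simp: continuous_functionals_def linear_iff)
  have lm: "l0 \<in> borel_measurable \<mu>"
    unfolding measurable_cong_sets[OF sets refl] by (rule borel_measurable_continuous_onI[OF lcont])
  have lcontS: "continuous_on A l0" for A using lcont by (rule continuous_on_subset) simp
  obtain a where a: "a \<in> S" "\<And>x. x \<in> S \<Longrightarrow> l0 a \<le> l0 x"
    using continuous_attains_inf[OF S(1) Sne lcontS] by blast
  obtain b where b: "b \<in> S" "\<And>x. x \<in> S \<Longrightarrow> l0 x \<le> l0 b"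
    using continuous_attains_sup[OF S(1) Sne lcontS] by blast
  define s0 s1 where "s0 = l0 a" and "s1 = l0 b"
  have s01: "s0 \<le> s1" using a(2)[OF b(1)] by (simp add: s0_def s1_def)
  \<comment> \<open>The affine section of \<open>l0\<close>. If \<open>s0 = s1\<close>, the quotient is 0 by convention and \<open>\<sigma>\<close> is constantly \<open>a\<close>, so that \<open>\<nu>\<close> is a point mass.\<close>
  define \<sigma> where "\<sigma> r = a + ((r - s0) / (s1 - s0)) *\<^sub>R (b - a)" for r
  have \<sigma>cont: "continuous_on UNIV \<sigma>"
    unfolding \<sigma>_def divide_inverse by (intro continuous_intros)
  have \<sigma>aff: "\<sigma> ((1 - t) *\<^sub>R x + t *\<^sub>R y) = (1 - t) *\<^sub>R \<sigma> x + t *\<^sub>R \<sigma> y" for x y t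
  proof -
    have "((1 - t) * x + t * y - s0) / (s1 - s0) = (1 - t) * ((x - s0) / (s1 - s0)) + t * ((y - s0) / (s1 - s0))"
      by (simp add: divide_inverse algebra_simps)
    then show ?thesis by (simp add: \<sigma>_def algebra_simps)
  qed
  have \<sigma>seg: "\<sigma> r \<in> closed_segment a b" if "r \<in> {s0..s1}" for r
  proof -
    have "0 \<le> (r - s0) / (s1 - s0)" "(r - s0) / (s1 - s0) \<le> 1"
      using that by (auto simp: divide_le_eq)
    then show ?thesis
      unfolding closed_segment_def \<sigma>_def
      by (intro CollectI exI[of _ "(r - s0) / (s1 - s0)"]) (simp add: algebra_simps)
  qed
  have segS: "closed_segment a b \<subseteq> S" by (rule closed_segment_subset[OF a(1) b(1) S(2)])
  have l\<sigma>: "l0 (\<sigma> r) = r" if "r \<in> {s0..s1}" for r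
  proof (cases "s0 = s1")
    case False
    then show ?thesis
      by (simp add: \<sigma>_def linear_add[OF lin] linear_scale[OF lin] linear_diff[OF lin] s0_def[symmetric] s1_def[symmetric])
  qed (use that in \<open>auto simp: \<sigma>_def s0_def\<close>)
  have lS: "l0 x \<in> {s0..s1}" if "x \<in> S" for x using a b that by (auto simp: s0_def s1_def)

  \<comment> \<open>The normalised restrictions to the decreasing sets, and their images on the real line.\<close>
  define N where "N n = uniform_measure \<mu> (C n)" for n
  have Nprob: "prob_space (N n)" for n
    unfolding N_def using Cpos[of n] by (intro prob_space_uniform_measure) (auto simp: emeasure_eq_measure)
  have Nsets: "sets (N n) = sets borel" for n by (simp add: N_def sets)
  have lmN: "l0 \<in> borel_measurable (N n)" for n
    unfolding measurable_cong_sets[OF Nsets refl] by (rule borel_measurable_continuous_onI[OF lcont])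
  have Nconc: "compact_concave \<alpha> (N n)" for n
    unfolding N_def by (rule compact_concave_uniform_measure[OF assms(2) sets conc C(2,3) Cpos])
  have Nfull: "measure (N n) (- C n) = 0" for n
    using CM[of n] Cpos[of n] sets.compl_sets[OF CM[of n]]
    by (subst N_def, subst measure_uniform_measure) (auto simp: emeasure_eq_measure space Compl_eq_Diff_UNIV)
  define P where "P n = distr (N n) borel l0" for n
  have Preal: "real_distribution (P n)" for n
    unfolding P_def real_distribution_def real_distribution_axioms_def
    using prob_space.prob_space_distr[OF Nprob lmN] by simp
  have Pconc: "compact_concave \<alpha> (P n)" for n
    unfolding P_def
    by (rule compact_concave_distr[OF prob_space.finite_measure[OF Nprob] Nsets Nconc lcont _ C(2) Nfull])
      (simp add: linear_functional_affine[OF lin])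
  have Pmass: "measure (P n) A = 1" if A: "A \<in> sets borel" "\<And>x. x \<in> C n \<Longrightarrow> l0 x \<in> A" for n A
  proof -
    interpret N: prob_space "N n" by (rule Nprob)
    have "AE x in N n. x \<in> C n"
      unfolding N_def using CM[of n] Cpos[of n] by (intro AE_uniform_measureI) auto
    then have "AE x in N n. l0 x \<in> A" by eventually_elim (use A(2) in blast)
    then have "N.prob {x \<in> space (N n). l0 x \<in> A} = 1"
      using measurable_sets[OF lmN A(1)] by (intro N.prob_eq_1[THEN iffD2]) (auto simp: vimage_def Int_def conj_commute)
    then show ?thesis
      using lmN A(1) by (simp add: P_def measure_distr vimage_def Int_def conj_commute)
  qed
  have "tight P"
    unfolding tight_def
  proof (intro conjI allI impI Preal)
    fix e :: real assume e: "0 < e"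
    obtain B where B: "0 < B" "\<And>x. x \<in> K \<Longrightarrow> \<bar>l0 x\<bar> \<le> B"
      using compact_imp_bounded[OF compact_continuous_image[OF lcontS K(1)]] unfolding bounded_pos
      by (metis image_eqI real_norm_def)
    have "l0 x \<in> {- B - 1<..B}" if "x \<in> C n" for x n
      using B(2)[of x] C(4)[of n] that by (auto simp: abs_le_iff)
    then have "measure (P n) {- B - 1<..B} = 1" for n by (intro Pmass) auto
    then show "\<exists>a b. a < b \<and> (\<forall>n. 1 - e < measure (P n) {a<..b})"
      using e B(1) by (intro exI[of _ "- B - 1"] exI[of _ B]) auto
  qed
  then obtain r \<pi> where r: "strict_mono r" and \<pi>: "real_distribution \<pi>" and weak: "weak_conv_m (P \<circ> id \<circ> r) \<pi>"
    using tight_imp_convergent_subsubsequence[of P id] by (auto simp: strict_mono_id)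
  interpret \<pi>: real_distribution \<pi> by fact
  have \<pi>sets: "sets \<pi> = sets borel" by simp
  have Preal': "real_distribution ((P \<circ> id \<circ> r) n)" for n by (simp add: Preal)
  have \<pi>conc: "compact_concave \<alpha> \<pi>"
    by (rule compact_concave_weak_limit[OF Preal' \<pi> weak]) (simp add: Pconc)
  have \<pi>mass: "measure \<pi> {s0..s1} = 1"
  proof (rule antisym[OF \<pi>.prob_le_1])
    show "1 \<le> measure \<pi> {s0..s1}"
    proof (rule weak_limit_closed[OF Preal' \<pi> weak])
      show "{s0..s1} \<noteq> {}" using s01 by simp
      fix \<delta> :: real assume \<delta>: "0 < \<delta>"
      have "\<forall>\<^sub>F n in sequentially. \<forall>x\<in>C n. infdist (l0 x) {s0..s1} < \<delta>"
        using \<delta> lS by (intro shrink continuous_on_infdist lcontS) auto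
      then have "\<forall>\<^sub>F n in sequentially. \<forall>x\<in>C (r n). infdist (l0 x) {s0..s1} < \<delta>"
        by (rule eventually_subseq[OF r])
      then show "\<forall>\<^sub>F n in sequentially. 1 \<le> measure ((P \<circ> id \<circ> r) n) {x. infdist x {s0..s1} \<le> \<delta>}"
      proof eventually_elim
        fix n assume "\<forall>x\<in>C (r n). infdist (l0 x) {s0..s1} < \<delta>"
        moreover have "closed {x. infdist x {s0..s1} \<le> \<delta>}" by (intro closed_Collect_le continuous_intros)
        ultimately show "1 \<le> measure ((P \<circ> id \<circ> r) n) {x. infdist x {s0..s1} \<le> \<delta>}"
          by (simp add: Pmass less_imp_le)
      qed
    qed simp
  qed
  have \<pi>ae: "AE x in \<pi>. x \<in> {s0..s1}"
    using \<pi>mass by (intro \<pi>.AE_prob_1) simp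
  have \<pi>null: "measure \<pi> (- {s0..s1}) = 0"
    using \<pi>.prob_compl[of "{s0..s1}"] \<pi>mass by (simp add: Compl_eq_Diff_UNIV)

  define \<nu> where "\<nu> = distr \<pi> borel \<sigma>"
  have \<sigma>m: "\<sigma> \<in> measurable \<pi> borel"
    unfolding measurable_cong_sets[OF \<pi>sets refl] by (rule borel_measurable_continuous_onI[OF \<sigma>cont])
  have \<nu>fin: "finite_measure \<nu>" unfolding \<nu>_def by (rule \<pi>.finite_measure_distr[OF \<sigma>m])
  have \<nu>conc: "alpha_concave \<alpha> \<nu>"
  proof (rule compact_concave_imp_alpha_concave[OF \<nu>fin])
    show "radon_measure \<nu>"
      unfolding \<nu>_def by (rule radon_measure_distr_real[OF \<pi>.finite_measure_axioms \<pi>sets \<sigma>cont])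
    show "compact_concave \<alpha> \<nu>"
      unfolding \<nu>_def
      by (rule compact_concave_distr[OF \<pi>.finite_measure_axioms \<pi>sets \<pi>conc \<sigma>cont \<sigma>aff compact_Icc \<pi>null])
  qed
  have segcl: "closed (closed_segment a b)"
    unfolding segment_convex_hull by (intro compact_imp_closed compact_convex_hull_finite) simp
  have supp: "supported_on \<nu> (closed_segment a b)"
    unfolding supported_on_def
  proof (rule conjI[OF segcl])
    have m: "- closed_segment a b \<in> sets borel" using segcl by (intro borel_open) auto
    have "emeasure \<nu> (- closed_segment a b) = emeasure \<pi> (\<sigma> -` (- closed_segment a b))"
      unfolding \<nu>_def using \<sigma>m m by (simp add: emeasure_distr)
    also have "\<dots> \<le> emeasure \<pi> (- {s0..s1})"
      using \<sigma>seg by (intro emeasure_mono) auto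
    also have "\<dots> = 0" using \<pi>null by (simp add: \<pi>.emeasure_eq_measure)
    finally show "emeasure \<nu> (- closed_segment a b) = 0" by simp
  qed

  have positive: "0 < extended_set_integral \<nu> (closed_segment a b) w"
    if h: "continuous_on K h" "\<forall>x\<in>K. \<forall>y\<in>K. (\<forall>l\<in>\<Lambda>. l x = l y) \<longrightarrow> h x = h y" "\<And>x. x \<in> K \<Longrightarrow> h x \<le> w x"
      and e: "0 < e" "\<And>n. 0 < (\<integral>x. indicator (C n) x * (h x - e) \<partial>\<mu>)"
      and w: "lower_semicontinuous w" for h w :: "'a \<Rightarrow> real" and e
  proof -
    \<comment> \<open>Clamping makes \<open>h \<circ> \<sigma>\<close> defined, bounded and continuous on the whole line, as weak convergence requires.\<close>
    define clamp where "clamp x = max s0 (min s1 x)" for x :: real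
    have clamp: "clamp x \<in> {s0..s1}" "x \<in> {s0..s1} \<Longrightarrow> clamp x = x" for x
      using s01 by (auto simp: clamp_def)
    define G where "G x = h (\<sigma> (clamp x))" for x
    have \<sigma>K: "\<sigma> (clamp x) \<in> K" for x using \<sigma>seg[OF clamp(1)] segS S(3) by blast
    have Gcont: "continuous_on UNIV G"
      unfolding G_def
    proof (rule continuous_on_compose2[OF h(1)])
      show "continuous_on UNIV (\<lambda>x. \<sigma> (clamp x))"
        unfolding clamp_def by (rule continuous_on_compose2[OF \<sigma>cont]) (auto intro!: continuous_intros)
    qed (use \<sigma>K in blast)
    obtain B where B: "0 < B" "\<And>x. x \<in> K \<Longrightarrow> \<bar>h x\<bar> \<le> B"
      using compact_imp_bounded[OF compact_continuous_image[OF h(1) K(1)]] unfolding bounded_pos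
      by (metis image_eqI real_norm_def)
    have GB: "\<bar>G x\<bar> \<le> B" for x unfolding G_def by (rule B(2)[OF \<sigma>K])
    have Gm: "G \<in> borel_measurable borel" by (rule borel_measurable_continuous_onI[OF Gcont])
    \<comment> \<open>On \<open>S\<close> all functionals of \<open>\<Lambda>\<close>, and hence \<open>h\<close>, are functions of \<open>l0\<close> alone.\<close>
    have GS: "G (l0 x) = h x" if x: "x \<in> S" for x
    proof -
      have \<sigma>S: "\<sigma> (l0 x) \<in> S" using \<sigma>seg[OF lS[OF x]] segS by blast
      have "l (\<sigma> (l0 x)) = l x" if l: "l \<in> \<Lambda>" for l
      proof -
        obtain a' b' where "\<forall>y\<in>S. l y = a' * l0 y + b'" using l0(2)[OF l] by (elim exE)
        then show ?thesis using \<sigma>S x l\<sigma>[OF lS[OF x]] by simp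
      qed
      then have "h (\<sigma> (l0 x)) = h x" using h(2) \<sigma>S x S(3) by blast
      then show ?thesis using clamp(2)[OF lS[OF x]] by (simp add: G_def)
    qed
    have Gl: "continuous_on A (\<lambda>x. G (l0 x))" for A
      by (rule continuous_on_compose2[OF Gcont lcontS]) simp
    have lower: "\<forall>\<^sub>F n in sequentially. e - \<delta> \<le> (\<integral>x. G x \<partial>P n)" if \<delta>: "0 < \<delta>" for \<delta>
    proof -
      have "\<forall>\<^sub>F n in sequentially. \<forall>x\<in>C n. \<bar>h x - G (l0 x)\<bar> < \<delta>"
        using \<delta> GS by (intro shrink continuous_intros h(1) Gl) auto
      then show ?thesis
      proof eventually_elim
        fix n assume n: "\<forall>x\<in>C n. \<bar>h x - G (l0 x)\<bar> < \<delta>"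
        have hc: "continuous_on (C n) h" using h(1) C(4) by (rule continuous_on_subset)
        note int = integrable_continuous_on_compact[OF assms(2) sets C(2)[of n]]
        have int_h: "integrable \<mu> (\<lambda>x. indicator (C n) x * (h x - e))"
          by (rule int[OF continuous_on_diff[OF hc continuous_on_const]])
        have int_c: "integrable \<mu> (\<lambda>x. indicator (C n) x * (e - \<delta>))"
          by (rule int[OF continuous_on_const])
        have "(e - \<delta>) * measure \<mu> (C n) = (\<integral>x. indicator (C n) x * (e - \<delta>) \<partial>\<mu>)"
          using CM by simp
        also have "\<dots> \<le> (\<integral>x. indicator (C n) x * (h x - e) \<partial>\<mu>) + (\<integral>x. indicator (C n) x * (e - \<delta>) \<partial>\<mu>)"
          using e(2)[of n] by simp
        also have "\<dots> = (\<integral>x. indicator (C n) x * (h x - e) + indicator (C n) x * (e - \<delta>) \<partial>\<mu>)"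
          by (rule Bochner_Integration.integral_add[OF int_h int_c, symmetric])
        also have "\<dots> \<le> (\<integral>x. indicator (C n) x * G (l0 x) \<partial>\<mu>)"
        proof (rule integral_mono)
          show "indicator (C n) x * (h x - e) + indicator (C n) x * (e - \<delta>) \<le> indicator (C n) x * G (l0 x)" for x
            using n by (auto split: split_indicator simp: abs_less_iff)
        qed (rule Bochner_Integration.integrable_add[OF int_h int_c], rule int[OF Gl])
        finally have "e - \<delta> \<le> (\<integral>x. indicator (C n) x * G (l0 x) \<partial>\<mu>) / measure \<mu> (C n)"
          using Cpos[of n] by (simp add: pos_le_divide_eq)
        also have "\<dots> = (\<integral>x. G (l0 x) \<partial>N n)"
          unfolding N_def
          by (rule integral_uniform_measure[OF assms(2) CM Cpos measurable_compose[OF lm Gm], symmetric])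
        also have "\<dots> = (\<integral>x. G x \<partial>P n)"
          unfolding P_def by (rule integral_distr[symmetric, OF lmN Gm])
        finally show "e - \<delta> \<le> (\<integral>x. G x \<partial>P n)" .
      qed
    qed
    have lim: "(\<lambda>n. \<integral>x. G x \<partial>(P \<circ> id \<circ> r) n) \<longlonglongrightarrow> (\<integral>x. G x \<partial>\<pi>)"
      using Gcont GB
      by (intro weak_conv_imp_integral_bdd_continuous_conv[OF Preal' \<pi> weak, of _ B])
        (auto simp: continuous_on_eq_continuous_at)
    have "e / 2 \<le> (\<integral>x. G x \<partial>\<pi>)"
    proof (rule tendsto_lowerbound[OF lim])
      have "\<forall>\<^sub>F n in sequentially. e - e / 2 \<le> (\<integral>x. G x \<partial>P (r n))"
        by (rule eventually_subseq[OF r lower]) (use e(1) in simp)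
      then show "\<forall>\<^sub>F n in sequentially. e / 2 \<le> (\<integral>x. G x \<partial>(P \<circ> id \<circ> r) n)" by simp
    qed simp
    then have Gpos: "0 < (\<integral>x. G x \<partial>\<pi>)" using e(1) by linarith
    show ?thesis
      unfolding \<nu>_def
    proof (rule extended_set_integral_distr_pos[OF \<pi>sets \<sigma>cont lower_semicontinuous_borel_measurable[OF w] borel_closed[OF segcl]])
      show "AE x in \<pi>. \<sigma> x \<in> closed_segment a b \<and> G x \<le> w (\<sigma> x)"
        using \<pi>ae
      proof eventually_elim
        fix x assume x: "x \<in> {s0..s1}"
        then show "\<sigma> x \<in> closed_segment a b \<and> G x \<le> w (\<sigma> x)"
          using \<sigma>seg[OF x] h(3)[OF \<sigma>K[of x]] by (simp add: G_def clamp(2)[OF x])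
      qed
      show "integrable \<pi> G"
        using Gm GB by (intro \<pi>.integrable_const_bound[of _ B]) auto
    qed (rule Gpos)
  qed
  have "\<forall>x\<in>K. \<forall>y\<in>K. (\<forall>l\<in>\<Lambda>. l x = l y) \<longrightarrow> f x = f y"
    unfolding \<Lambda>_def ball_Un using \<Lambda>f(3) by blast
  then have "0 < extended_set_integral \<nu> (closed_segment a b) u"
    by (rule positive[OF fcont _ f(2) e1(1) C(5) assms(4)])
  moreover have "\<forall>x\<in>K. \<forall>y\<in>K. (\<forall>l\<in>\<Lambda>. l x = l y) \<longrightarrow> g x = g y"
    unfolding \<Lambda>_def ball_Un using \<Lambda>g(3) by blast
  then have "0 < extended_set_integral \<nu> (closed_segment a b) v"
    by (rule positive[OF gcont _ g(2) e2(1) C(6) assms(5)])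
  ultimately show ?thesis using \<nu>fin \<nu>conc supp by (intro exI conjI)
qed

end
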